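(* Let $(M,g)$ be an $n$-dimensional ($n>3$) weakly $Z$ symmetric manifold $(WZS)_n$ that is quasi conformally harmonic, $\nabla_mW_{jkl}{}^m=0$, with $\eta_k\neq 0$. If $$\eta_j\nabla_k\phi-\eta_k\nabla_j\phi=0,$$ then $\eta_i/\|\eta\|$ is a proper concircular vector.
   Context: $(M,g)$ is an $n$-dimensional Riemannian manifold with Levi-Civita connection $\nabla$; index notation with summation over repeated indices; $R_{jkl}{}^m$ is the Riemann tensor, $R_{kl}=-R_{mkl}{}^m$ the Ricci tensor, $R=g^{ij}R_{ij}$ the scalar curvature. Generalized $Z$ tensor: $Z_{kl}=R_{kl}+\phi\,g_{kl}$, where $\phi$ is an arbitrary scalar function. The manifold is weakly $Z$ symmetric, $(WZS)_n$, if for some $\phi$ there are covectors $A_k,B_k,D_k$ with $$\nabla_kZ_{jl}=A_kZ_{jl}+B_jZ_{kl}+D_lZ_{kj}.$$ Put $\eta_k=B_k-D_k$ and $\|\eta\|=\sqrt{\eta^k\eta_k}$; the hypothesis $\eta_k\ne0$ is understood pointwise. Conformal curvature tensor: $$C_{jkl}{}^m=R_{jkl}{}^m+\tfrac{1}{n-2}(\delta_j{}^mR_{kl}-\delta_k{}^mR_{jl}+R_j{}^mg_{kl}-R_k{}^mg_{jl})-\tfrac{R}{(n-1)(n-2)}(\delta_j{}^mg_{kl}-\delta_k{}^mg_{jl}).$$ Concircular curvature tensor: $\tilde C_{jkl}{}^m=R_{jkl}{}^m+\frac{R}{n(n-1)}(\delta_j{}^mg_{kl}-\delta_k{}^mg_{jl})$.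 Quasi conformal curvature tensor: $W_{jkl}{}^m=-(n-2)\,b\,C_{jkl}{}^m+[a+(n-2)b]\,\tilde C_{jkl}{}^m$, with $a,b$ nonzero constants. A covector $X_l$ is concircular if $\nabla_jX_l=\mu_jX_l+\rho\,g_{jl}$ for some covector $\mu_j$ and scalar function $\rho$; it is proper concircular if moreover $\mu_j$ is a closed 1-form ($\nabla_i\mu_j=\nabla_j\mu_i$). For a unit covector $T_l$ this means $\nabla_jT_l=f(T_jT_l-g_{jl})$ for a scalar function $f$ with $fT_k$ closed.
   Formalization: Adds that Z does not vanish identically on any nonempty open set; without this the claim fails, e.g. on flat R^4 with φ=0, A=D=0, B=dx^1+x^1dx^2, where Z=0 and the weakly Z symmetric equation is vacuous. *)

theory Defs
  imports "HOL-Analysis.Analysis"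
begin

definition partial :: "'n::finite \<Rightarrow> (real^'n \<Rightarrow> real) \<Rightarrow> real^'n \<Rightarrow> real" where
  "partial i f x = frechet_derivative f (at x) (axis i 1)"

text \<open>Intended for open sets only, where this is the usual class of \<open>k\<close> times
  continuously differentiable functions.\<close>

primrec C_k_on :: "nat \<Rightarrow> (real^'n::finite) set \<Rightarrow> (real^'n \<Rightarrow> real) \<Rightarrow> bool" where
  "C_k_on 0 S f \<longleftrightarrow> continuous_on S f"
| "C_k_on (Suc k) S f \<longleftrightarrow>
     (\<forall>x\<in>S. f differentiable (at x)) \<and> (\<forall>i. C_k_on k S (partial i f))"

definition smooth_on :: "(real^'n::finite) set \<Rightarrow> (real^'n \<Rightarrow> real) \<Rightarrow> bool" where
  "smooth_on S f \<longleftrightarrow> (\<forall>k. C_k_on k S f)"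

text \<open>A chart is a domain together with its coordinate map; the values of the coordinate map
  outside the domain are irrelevant.  The underlying set of the manifold is the whole type
  \<open>'p\<close>, and its dimension \<open>n\<close> is \<open>CARD('n)\<close>.\<close>

type_synonym ('p, 'n) chart = "'p set \<times> ('p \<Rightarrow> real^'n)"
type_synonym ('p, 'n) atlas = "('p, 'n) chart set"

abbreviation chart_dom :: "('p, 'n) chart \<Rightarrow> 'p set" where
  "chart_dom c \<equiv> fst c"

abbreviation coord :: "('p, 'n) chart \<Rightarrow> 'p \<Rightarrow> real^'n" where
  "coord c \<equiv> snd c"

definition param :: "('p, 'n) chart \<Rightarrow> real^'n \<Rightarrow> 'p" where
  "param c = inv_into (chart_dom c) (coord c)"

definition smooth_manifold ::
    "('p::{t2_space,second_countable_topology}, 'n::finite) atlas \<Rightarrow> bool" where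
  "smooth_manifold M \<longleftrightarrow>
     (\<Union>c\<in>M. chart_dom c) = UNIV \<and>
     (\<forall>c\<in>M. open (chart_dom c) \<and> open (coord c ` chart_dom c) \<and>
        homeomorphism (chart_dom c) (coord c ` chart_dom c) (coord c) (param c)) \<and>
     (\<forall>c\<in>M. \<forall>d\<in>M. \<forall>i.
        smooth_on (coord c ` (chart_dom c \<inter> chart_dom d)) (\<lambda>y. coord d (param c y) $ i))"

text \<open>\<open>pd c i f p\<close> is the partial derivative of \<open>f\<close> at \<open>p\<close> with respect to the
  \<open>i\<close>-th coordinate of the chart \<open>c\<close>.\<close>

definition pd :: "('p, 'n::finite) chart \<Rightarrow> 'n \<Rightarrow> ('p \<Rightarrow> real) \<Rightarrow> 'p \<Rightarrow> real" where
  "pd c i f p = partial i (f \<circ> param c) (coord c p)"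

definition smooth_in :: "('p, 'n::finite) chart \<Rightarrow> ('p \<Rightarrow> real) \<Rightarrow> bool" where
  "smooth_in c f \<longleftrightarrow> smooth_on (coord c ` chart_dom c) (f \<circ> param c)"

text \<open>Jacobian: the derivative of the \<open>i\<close>-th coordinate of \<open>c\<close> with respect to the
  \<open>k\<close>-th coordinate of \<open>d\<close>.\<close>

definition jac :: "('p, 'n::finite) chart \<Rightarrow> ('p, 'n) chart \<Rightarrow> 'p \<Rightarrow> 'n \<Rightarrow> 'n \<Rightarrow> real" where
  "jac c d p i k = pd d k (\<lambda>q. coord c q $ i) p"

text \<open>Tensor fields are given classically, by their components in every chart of the atlas,
  subject to the transformation law under a change of chart.\<close>

type_synonym ('p, 'n) covec = "('p, 'n) chart \<Rightarrow> 'p \<Rightarrow> real^'n"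
type_synonym ('p, 'n) metric = "('p, 'n) chart \<Rightarrow> 'p \<Rightarrow> real^'n^'n"

definition scalar_field :: "('p, 'n::finite) atlas \<Rightarrow> ('p \<Rightarrow> real) \<Rightarrow> bool" where
  "scalar_field M f \<longleftrightarrow> (\<forall>c\<in>M. smooth_in c f)"

definition covector_field :: "('p, 'n::finite) atlas \<Rightarrow> ('p, 'n) covec \<Rightarrow> bool" where
  "covector_field M X \<longleftrightarrow>
     (\<forall>c\<in>M. \<forall>k. smooth_in c (\<lambda>p. X c p $ k)) \<and>
     (\<forall>c\<in>M. \<forall>d\<in>M. \<forall>p\<in>chart_dom c \<inter> chart_dom d. \<forall>k.
        X d p $ k = (\<Sum>i\<in>UNIV. jac c d p i k * X c p $ i))"

definition riemannian_metric :: "('p, 'n::finite) atlas \<Rightarrow> ('p, 'n) metric \<Rightarrow> bool" where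
  "riemannian_metric M g \<longleftrightarrow>
     (\<forall>c\<in>M. \<forall>k l. smooth_in c (\<lambda>p. g c p $ k $ l)) \<and>
     (\<forall>c\<in>M. \<forall>d\<in>M. \<forall>p\<in>chart_dom c \<inter> chart_dom d. \<forall>k l.
        g d p $ k $ l =
          (\<Sum>i\<in>UNIV. \<Sum>j\<in>UNIV. jac c d p i k * jac c d p j l * g c p $ i $ j)) \<and>
     (\<forall>c\<in>M. \<forall>p\<in>chart_dom c.
        transpose (g c p) = g c p \<and> (\<forall>v. v \<noteq> 0 \<longrightarrow> v \<bullet> (g c p *v v) > 0))"

definition riemannian_manifold ::
    "('p::{t2_space,second_countable_topology}, 'n::finite) atlas \<Rightarrow> ('p, 'n) metric \<Rightarrow> bool" where
  "riemannian_manifold M g \<longleftrightarrow> smooth_manifold M \<and> riemannian_metric M g"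

definition ginv :: "('p, 'n::finite) metric \<Rightarrow> ('p, 'n) chart \<Rightarrow> 'p \<Rightarrow> 'n \<Rightarrow> 'n \<Rightarrow> real" where
  "ginv g c p i j = matrix_inv (g c p) $ i $ j"

definition conorm :: "('p, 'n::finite) metric \<Rightarrow> ('p, 'n) covec \<Rightarrow> ('p, 'n) chart \<Rightarrow> 'p \<Rightarrow> real" where
  "conorm g X c p = sqrt (\<Sum>k\<in>UNIV. \<Sum>l\<in>UNIV. ginv g c p k l * X c p $ k * X c p $ l)"

text \<open>\<open>christoffel g c p m i j\<close> is the Christoffel symbol with upper index \<open>m\<close> and
  lower indices \<open>i\<close>, \<open>j\<close>.  In the covariant derivatives below the first index is that of
  the derivative; in a tensor with one upper index, that index comes last.\<close>

definition christoffel ::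
    "('p, 'n::finite) metric \<Rightarrow> ('p, 'n) chart \<Rightarrow> 'p \<Rightarrow> 'n \<Rightarrow> 'n \<Rightarrow> 'n \<Rightarrow> real" where
  "christoffel g c p m i j = (\<Sum>r\<in>UNIV. ginv g c p m r / 2 *
     (pd c i (\<lambda>q. g c q $ r $ j) p + pd c j (\<lambda>q. g c q $ r $ i) p
        - pd c r (\<lambda>q. g c q $ i $ j) p))"

definition nabla1 ::
    "('p, 'n::finite) metric \<Rightarrow> ('p, 'n) covec \<Rightarrow> ('p, 'n) chart \<Rightarrow> 'p \<Rightarrow> 'n \<Rightarrow> 'n \<Rightarrow> real" where
  "nabla1 g X c p k l =
     pd c k (\<lambda>q. X c q $ l) p - (\<Sum>m\<in>UNIV. christoffel g c p m k l * X c p $ m)"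

definition nabla2 ::
    "('p, 'n::finite) metric \<Rightarrow> (('p, 'n) chart \<Rightarrow> 'p \<Rightarrow> 'n \<Rightarrow> 'n \<Rightarrow> real) \<Rightarrow>
      ('p, 'n) chart \<Rightarrow> 'p \<Rightarrow> 'n \<Rightarrow> 'n \<Rightarrow> 'n \<Rightarrow> real" where
  "nabla2 g S c p k j l =
     pd c k (\<lambda>q. S c q j l) p
     - (\<Sum>m\<in>UNIV. christoffel g c p m k j * S c p m l)
     - (\<Sum>m\<in>UNIV. christoffel g c p m k l * S c p j m)"

definition nabla31 ::
    "('p, 'n::finite) metric \<Rightarrow> (('p, 'n) chart \<Rightarrow> 'p \<Rightarrow> 'n \<Rightarrow> 'n \<Rightarrow> 'n \<Rightarrow> 'n \<Rightarrow> real) \<Rightarrow>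
      ('p, 'n) chart \<Rightarrow> 'p \<Rightarrow> 'n \<Rightarrow> 'n \<Rightarrow> 'n \<Rightarrow> 'n \<Rightarrow> 'n \<Rightarrow> real" where
  "nabla31 g S c p i j k l m =
     pd c i (\<lambda>q. S c q j k l m) p
     - (\<Sum>r\<in>UNIV. christoffel g c p r i j * S c p r k l m)
     - (\<Sum>r\<in>UNIV. christoffel g c p r i k * S c p j r l m)
     - (\<Sum>r\<in>UNIV. christoffel g c p r i l * S c p j k r m)
     + (\<Sum>r\<in>UNIV. christoffel g c p m i r * S c p j k l r)"

text \<open>The sign is that of the Ricci identity
  \<open>\<nabla>\<^sub>j \<nabla>\<^sub>k X\<^sub>l - \<nabla>\<^sub>k \<nabla>\<^sub>j X\<^sub>l = R\<^sub>j\<^sub>k\<^sub>l\<^sup>m X\<^sub>m\<close>.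
  With \<open>R\<^sub>k\<^sub>l = - R\<^sub>m\<^sub>k\<^sub>l\<^sup>m\<close> it makes the Ricci tensor of a round sphere positive.\<close>

definition riemann ::
    "('p, 'n::finite) metric \<Rightarrow> ('p, 'n) chart \<Rightarrow> 'p \<Rightarrow> 'n \<Rightarrow> 'n \<Rightarrow> 'n \<Rightarrow> 'n \<Rightarrow> real" where
  "riemann g c p j k l m =
     pd c k (\<lambda>q. christoffel g c q m j l) p - pd c j (\<lambda>q. christoffel g c q m k l) p
     + (\<Sum>r\<in>UNIV. christoffel g c p m k r * christoffel g c p r j l
                - christoffel g c p m j r * christoffel g c p r k l)"

definition ricci ::
    "('p, 'n::finite) metric \<Rightarrow> ('p, 'n) chart \<Rightarrow> 'p \<Rightarrow> 'n \<Rightarrow> 'n \<Rightarrow> real" where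
  "ricci g c p k l = - (\<Sum>m\<in>UNIV. riemann g c p m k l m)"

definition ricci_mixed ::
    "('p, 'n::finite) metric \<Rightarrow> ('p, 'n) chart \<Rightarrow> 'p \<Rightarrow> 'n \<Rightarrow> 'n \<Rightarrow> real" where
  "ricci_mixed g c p j m = (\<Sum>r\<in>UNIV. ginv g c p m r * ricci g c p j r)"

definition scalar_curv :: "('p, 'n::finite) metric \<Rightarrow> ('p, 'n) chart \<Rightarrow> 'p \<Rightarrow> real" where
  "scalar_curv g c p = (\<Sum>i\<in>UNIV. \<Sum>j\<in>UNIV. ginv g c p i j * ricci g c p i j)"

definition kron :: "'n \<Rightarrow> 'n \<Rightarrow> real" where
  "kron j m = (if j = m then 1 else 0)"

definition conformal_curv ::
    "('p, 'n::finite) metric \<Rightarrow> ('p, 'n) chart \<Rightarrow> 'p \<Rightarrow> 'n \<Rightarrow> 'n \<Rightarrow> 'n \<Rightarrow> 'n \<Rightarrow> real" where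
  "conformal_curv g c p j k l m = (let n = real CARD('n) in
     riemann g c p j k l m
     + 1 / (n - 2) *
         (kron j m * ricci g c p k l - kron k m * ricci g c p j l
          + ricci_mixed g c p j m * g c p $ k $ l - ricci_mixed g c p k m * g c p $ j $ l)
     - scalar_curv g c p / ((n - 1) * (n - 2)) *
         (kron j m * g c p $ k $ l - kron k m * g c p $ j $ l))"

definition concircular_curv ::
    "('p, 'n::finite) metric \<Rightarrow> ('p, 'n) chart \<Rightarrow> 'p \<Rightarrow> 'n \<Rightarrow> 'n \<Rightarrow> 'n \<Rightarrow> 'n \<Rightarrow> real" where
  "concircular_curv g c p j k l m = (let n = real CARD('n) in
     riemann g c p j k l m
     + scalar_curv g c p / (n * (n - 1)) *
         (kron j m * g c p $ k $ l - kron k m * g c p $ j $ l))"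

definition quasi_conformal_curv ::
    "real \<Rightarrow> real \<Rightarrow> ('p, 'n::finite) metric \<Rightarrow> ('p, 'n) chart \<Rightarrow> 'p \<Rightarrow>
      'n \<Rightarrow> 'n \<Rightarrow> 'n \<Rightarrow> 'n \<Rightarrow> real" where
  "quasi_conformal_curv a b g c p j k l m = (let n = real CARD('n) in
     - (n - 2) * b * conformal_curv g c p j k l m
     + (a + (n - 2) * b) * concircular_curv g c p j k l m)"

definition quasi_conformally_harmonic ::
    "real \<Rightarrow> real \<Rightarrow> ('p, 'n::finite) atlas \<Rightarrow> ('p, 'n) metric \<Rightarrow> bool" where
  "quasi_conformally_harmonic a b M g \<longleftrightarrow>
     (\<forall>c\<in>M. \<forall>p\<in>chart_dom c. \<forall>j k l.
        (\<Sum>m\<in>UNIV. nabla31 g (quasi_conformal_curv a b g) c p m j k l m) = 0)"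

definition Z_tensor ::
    "('p, 'n::finite) metric \<Rightarrow> ('p \<Rightarrow> real) \<Rightarrow> ('p, 'n) chart \<Rightarrow> 'p \<Rightarrow> 'n \<Rightarrow> 'n \<Rightarrow> real" where
  "Z_tensor g \<phi> c p k l = ricci g c p k l + \<phi> p * g c p $ k $ l"

text \<open>The scalar function \<open>\<phi>\<close> and the covectors \<open>A\<close>, \<open>B\<close>, \<open>D\<close> are parameters, since
  they are referred to outside the definition.\<close>

definition weakly_Z_symmetric ::
    "('p, 'n::finite) atlas \<Rightarrow> ('p, 'n) metric \<Rightarrow> ('p \<Rightarrow> real) \<Rightarrow>
      ('p, 'n) covec \<Rightarrow> ('p, 'n) covec \<Rightarrow> ('p, 'n) covec \<Rightarrow> bool" where
  "weakly_Z_symmetric M g \<phi> A B D \<longleftrightarrow>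
     scalar_field M \<phi> \<and> covector_field M A \<and> covector_field M B \<and> covector_field M D \<and>
     (\<forall>c\<in>M. \<forall>p\<in>chart_dom c. \<forall>k j l.
        nabla2 g (Z_tensor g \<phi>) c p k j l =
          A c p $ k * Z_tensor g \<phi> c p j l + B c p $ j * Z_tensor g \<phi> c p k l
          + D c p $ l * Z_tensor g \<phi> c p k j)"

text \<open>The usual nondegeneracy convention for the weakly symmetric family (the tensor in
  question is not identically zero), in a form which does not presuppose that the manifold is
  connected.  Where \<open>Z\<close> vanishes on an open set the defining equation reads \<open>0 = 0\<close> and
  puts no restriction on \<open>A\<close>, \<open>B\<close>, \<open>D\<close>.\<close>

definition Z_nontrivial ::
    "('p::topological_space, 'n::finite) atlas \<Rightarrow> ('p, 'n) metric \<Rightarrow> ('p \<Rightarrow> real) \<Rightarrow> bool" where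
  "Z_nontrivial M g \<phi> \<longleftrightarrow>
     (\<forall>V. open V \<and> V \<noteq> {} \<longrightarrow>
        (\<exists>c\<in>M. \<exists>p\<in>V \<inter> chart_dom c. \<exists>k l. Z_tensor g \<phi> c p k l \<noteq> 0))"

definition closed_covector :: "('p, 'n::finite) atlas \<Rightarrow> ('p, 'n) metric \<Rightarrow> ('p, 'n) covec \<Rightarrow> bool" where
  "closed_covector M g X \<longleftrightarrow>
     (\<forall>c\<in>M. \<forall>p\<in>chart_dom c. \<forall>i j. nabla1 g X c p i j = nabla1 g X c p j i)"

definition proper_concircular ::
    "('p, 'n::finite) atlas \<Rightarrow> ('p, 'n) metric \<Rightarrow> ('p, 'n) covec \<Rightarrow> bool" where
  "proper_concircular M g X \<longleftrightarrow>
     covector_field M X \<and>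
     (\<exists>\<mu> \<rho>. covector_field M \<mu> \<and> scalar_field M \<rho> \<and> closed_covector M g \<mu> \<and>
        (\<forall>c\<in>M. \<forall>p\<in>chart_dom c. \<forall>j l.
           nabla1 g X c p j l = \<mu> c p $ j * X c p $ l + \<rho> p * g c p $ j $ l))"

end

theory Submission
  imports Defs
begin

text \<open>In fact \<open>u = \<eta> / \<parallel>\<eta>\<parallel>\<close> is parallel, so that both \<open>\<mu>\<close> and \<open>\<rho>\<close> may be taken to be \<open>0\<close>.
  Antisymmetrizing the defining equation in the indices of \<open>Z\<close> shows \<open>Z = z u \<otimes> u\<close>, and then the
  equation itself gives \<open>z \<nabla>\<^sub>k u\<^sub>j = u\<^sub>k \<alpha>\<^sub>j\<close> with \<open>\<alpha>\<close> orthogonal to \<open>u\<close>.  Let \<open>w\<close> be the component of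
  \<open>\<nabla>z\<close> orthogonal to \<open>u\<close>.  Since \<open>\<nabla>\<phi>\<close> is a multiple of \<open>u\<close>, the contracted Bianchi identity gives
  \<open>\<alpha> = w / 2\<close>.  The divergence of \<open>W\<close> is
  \<open>(a + b) (\<nabla>\<^sub>k R\<^sub>j\<^sub>l - \<nabla>\<^sub>j R\<^sub>k\<^sub>l) + \<delta> (g\<^sub>k\<^sub>l \<nabla>\<^sub>j R - g\<^sub>j\<^sub>l \<nabla>\<^sub>k R)\<close>; contracting it with \<open>u\<^sup>k u\<^sup>l\<close> and with
  \<open>g\<^sup>k\<^sup>l\<close> yields \<open>\<delta> w = 0\<close> and \<open>(a + b) w = 0\<close>, whose coefficients do not vanish together when \<open>n > 3\<close>.
  Hence \<open>\<nabla>u = 0\<close> wherever \<open>Z \<noteq> 0\<close>, and everywhere by density and continuity.\<close>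

section \<open>Partial derivatives\<close>

text \<open>The defining equation sees the derivative of \<open>u\<close> only through its product
  with \<open>z\<close>, so the zeros of \<open>Z\<close> are the obstacle: at such a point nothing
  follows pointwise. \<open>Z_nontrivial\<close> makes the points with nonzero \<open>Z\<close>
  dense. A tensor field being a family of component arrays indexed by charts, such a point may come
  with a different chart, and the transformation law of the covariant derivative is what links the
  two charts. The constant \<delta> collects every gradient of the scalar curvature in the
  divergence of \<open>W\<close>. For \<open>a + b = 0\<close> it equals
  \<open>- b (n - 2) (n - 3) / (2 n (n - 1))\<close>, which shows where dimension 3 would break the
  argument.\<close>

lemma has_derivative_partial:
  assumes "(f has_derivative f') (at x)"
  shows "partial i f x = f' (axis i 1)"
  using frechet_derivative_at[OF assms] by (simp add: partial_def)

text \<open>\<open>frechet_derivative\<close> is a choice among all derivatives, so it depends on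
  the function only through \<open>has_derivative\<close>. That predicate is local, and so the two
  chosen values agree.\<close>

lemma partial_cong:
  assumes "open S" "x \<in> S" "\<And>y. y \<in> S \<Longrightarrow> f y = g y"
  shows "partial i f x = partial i g x"
proof -
  have "(f has_derivative D) (at x) \<longleftrightarrow> (g has_derivative D) (at x)" for D
    using assms has_derivative_transform_within_open[OF _ assms(1,2)] by metis
  then show ?thesis by (simp add: partial_def frechet_derivative_def)
qed

lemma differentiable_cong_open:
  assumes "open S" "x \<in> S" "\<And>y. y \<in> S \<Longrightarrow> f y = g y" "f differentiable (at x)"
  shows "g differentiable (at x)"
  using assms has_derivative_transform_within_open[OF _ assms(1,2)]
  unfolding differentiable_def by metis

lemma partial_const [simp]: "partial i (\<lambda>x. c) = (\<lambda>x. 0)"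
  by (simp add: partial_def fun_eq_iff)

lemma partial_add:
  assumes "f differentiable (at x)" "g differentiable (at x)"
  shows "partial i (\<lambda>x. f x + g x) x = partial i f x + partial i g x"
  using has_derivative_partial[OF has_derivative_add[OF assms[unfolded frechet_derivative_works]]]
  by (simp add: partial_def)

lemma partial_mult:
  assumes "f differentiable (at x)" "g differentiable (at x)"
  shows "partial i (\<lambda>x. f x * g x) x = partial i f x * g x + f x * partial i g x"
  using has_derivative_partial[OF has_derivative_mult[OF assms[unfolded frechet_derivative_works]]]
  by (simp add: partial_def)

lemma partial_powr:
  assumes "f differentiable (at x)" "f x > 0"
  shows "(\<lambda>x. f x powr s) differentiable (at x)"
    "partial i (\<lambda>x. f x powr s) x = s * f x powr (s - 1) * partial i f x"
proof -
  have "((\<lambda>y. y powr s) has_derivative (\<lambda>h. h * (s * f x powr (s - 1)))) (at (f x))"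
    using has_real_derivative_powr[OF assms(2), of s]
    by (simp add: has_field_derivative_def mult_commute_abs)
  from has_derivative_compose[OF assms(1)[unfolded frechet_derivative_works] this]
  have *: "((\<lambda>x. f x powr s) has_derivative
      (\<lambda>h. frechet_derivative f (at x) h * (s * f x powr (s - 1)))) (at x)" .
  show "(\<lambda>x. f x powr s) differentiable (at x)" using * unfolding differentiable_def by blast
  show "partial i (\<lambda>x. f x powr s) x = s * f x powr (s - 1) * partial i f x"
    using has_derivative_partial[OF *] by (simp add: partial_def)
qed

section \<open>Stability of the class C^k under sums, products and real powers\<close>

lemma C_k_on_cong:
  assumes "open S" "\<And>y. y \<in> S \<Longrightarrow> f y = g y" "C_k_on k S f"
  shows "C_k_on k S g"
  using assms(2,3)
proof (induction k arbitrary: f g)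
  case 0
  then show ?case using continuous_on_cong by fastforce
next
  case (Suc k)
  have "C_k_on k S (partial i g)" for i
    using Suc.IH[of "partial i f" "partial i g"] Suc.prems partial_cong[OF assms(1), of _ f g i]
    by auto
  then show ?case
    using Suc.prems differentiable_cong_open[OF assms(1), of _ f g] by auto
qed

text \<open>The recursive clause of \<open>C_k_on\<close> asks for differentiability and does not
  mention continuity of \<open>f\<close>; monotonicity in \<open>k\<close> rests on differentiable
  functions being continuous.\<close>

lemma C_k_on_Suc_D: "C_k_on (Suc k) S f \<Longrightarrow> C_k_on k S f"
proof (induction k arbitrary: f)
  case 0
  then show ?case
    by (auto intro!: continuous_at_imp_continuous_on differentiable_imp_continuous_within)
qed auto

lemma C_k_on_const [simp]: "C_k_on k S (\<lambda>x. c)"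
  by (induction k arbitrary: c) auto

lemma C_k_on_add:
  assumes "open S"
  shows "C_k_on k S f \<Longrightarrow> C_k_on k S g \<Longrightarrow> C_k_on k S (\<lambda>x. f x + g x)"
proof (induction k arbitrary: f g)
  case 0
  then show ?case by (auto intro: continuous_on_add)
next
  case (Suc k)
  have "C_k_on k S (\<lambda>x. partial i f x + partial i g x)" for i using Suc by auto
  then have "C_k_on k S (partial i (\<lambda>x. f x + g x))" for i
    by (rule C_k_on_cong[OF assms, rotated]) (use Suc.prems in \<open>simp add: partial_add\<close>)
  then show ?case using Suc.prems by (auto intro: differentiable_add)
qed

lemma C_k_on_mult:
  assumes "open S"
  shows "C_k_on k S f \<Longrightarrow> C_k_on k S g \<Longrightarrow> C_k_on k S (\<lambda>x. f x * g x)"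
proof (induction k arbitrary: f g)
  case 0
  then show ?case by (auto intro: continuous_on_mult)
next
  case (Suc k)
  have "C_k_on k S (\<lambda>x. partial i f x * g x + f x * partial i g x)" for i
    using Suc.prems C_k_on_Suc_D[OF Suc.prems(1)] C_k_on_Suc_D[OF Suc.prems(2)]
    by (intro C_k_on_add[OF assms] Suc.IH) auto
  then have "C_k_on k S (partial i (\<lambda>x. f x * g x))" for i
    by (rule C_k_on_cong[OF assms, rotated]) (use Suc.prems in \<open>simp add: partial_mult\<close>)
  then show ?case using Suc.prems by (auto intro: differentiable_mult)
qed

text \<open>The chain rule lowers the exponent by one, hence the induction with \<open>s\<close>
  arbitrary. Exponent -1 serves for reciprocals, exponent -1/2 for the normalization of a
  covector.\<close>

lemma C_k_on_powr:
  assumes "open S" "\<And>x. x \<in> S \<Longrightarrow> f x > 0"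
  shows "C_k_on k S f \<Longrightarrow> C_k_on k S (\<lambda>x. f x powr s)"
proof (induction k arbitrary: s)
  case 0
  then show ?case using assms(2) by (force intro!: continuous_on_powr)
next
  case (Suc k)
  have "C_k_on k S (\<lambda>x. s * f x powr (s - 1) * partial i f x)" for i
    using Suc C_k_on_Suc_D[OF Suc.prems] by (intro C_k_on_mult[OF assms(1)]) auto
  then have "C_k_on k S (partial i (\<lambda>x. f x powr s))" for i
    by (rule C_k_on_cong[OF assms(1), rotated, where f = "\<lambda>x. s * f x powr (s - 1) * partial i f x"])
      (use Suc.prems assms in \<open>simp add: partial_powr\<close>)
  then show ?case using Suc.prems assms by (auto intro: partial_powr)
qed

section \<open>Symmetry of second partial derivatives\<close>

lemma has_real_derivative_line:
  assumes "f differentiable (at (y + t *\<^sub>R axis i 1))"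
  shows "((\<lambda>t. f (y + t *\<^sub>R axis i 1)) has_real_derivative partial i f (y + t *\<^sub>R axis i 1)) (at t)"
proof -
  let ?x = "y + t *\<^sub>R axis i 1" and ?D = "frechet_derivative f (at (y + t *\<^sub>R axis i 1))"
  have "((\<lambda>t. y + t *\<^sub>R axis i 1) has_derivative (\<lambda>h. h *\<^sub>R axis i 1)) (at t)"
    by (auto intro!: derivative_eq_intros)
  from has_derivative_compose[OF this assms[unfolded frechet_derivative_works]]
  have "((\<lambda>t. f (y + t *\<^sub>R axis i 1)) has_derivative (\<lambda>h. ?D (h *\<^sub>R axis i 1))) (at t)" .
  moreover have "?D (h *\<^sub>R axis i 1) = partial i f ?x * h" for h
    using linear_frechet_derivative[OF assms] by (simp add: partial_def linear_scale)
  ultimately show ?thesis by (simp add: has_field_derivative_def)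
qed

text \<open>The second difference over a square of side \<open>h\<close> is the increment of
  \<open>F\<close>, the difference of \<open>f\<close> along two opposite edges. The mean value
  theorem in direction \<open>i\<close> and then in direction \<open>j\<close> turns it into a mixed
  derivative at an interior point.\<close>

lemma second_difference:
  assumes C: "C_k_on 2 S f" and h: "h > 0"
    and sub: "\<And>s t. 0 \<le> s \<Longrightarrow> s \<le> h \<Longrightarrow> 0 \<le> t \<Longrightarrow> t \<le> h \<Longrightarrow>
      x + s *\<^sub>R axis i 1 + t *\<^sub>R axis j 1 \<in> S"
  obtains s t where "0 < s" "s < h" "0 < t" "t < h"
    "f (x + h *\<^sub>R axis i 1 + h *\<^sub>R axis j 1) - f (x + h *\<^sub>R axis i 1)
       - f (x + h *\<^sub>R axis j 1) + f x
     = h\<^sup>2 * partial j (partial i f) (x + s *\<^sub>R axis i 1 + t *\<^sub>R axis j 1)"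
proof -
  have d1: "f differentiable (at y)" and d2: "partial i f differentiable (at y)" if "y \<in> S" for y
    using C that by (auto simp: numeral_2_eq_2)
  define F where "F t = f ((x + h *\<^sub>R axis j 1) + t *\<^sub>R axis i 1) - f (x + t *\<^sub>R axis i 1)" for t
  have F: "(F has_real_derivative (partial i f ((x + h *\<^sub>R axis j 1) + t *\<^sub>R axis i 1)
        - partial i f (x + t *\<^sub>R axis i 1))) (at t)" if "0 \<le> t" "t \<le> h" for t
    unfolding F_def using sub[of t h] sub[of t 0] that h
    by (intro DERIV_diff has_real_derivative_line d1) (auto simp: algebra_simps)
  obtain s where s: "0 < s" "s < h" and eq1: "F h - F 0 = h *
      (partial i f ((x + h *\<^sub>R axis j 1) + s *\<^sub>R axis i 1) - partial i f (x + s *\<^sub>R axis i 1))"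
    using MVT2[OF h F] by auto
  have G: "((\<lambda>t. partial i f ((x + s *\<^sub>R axis i 1) + t *\<^sub>R axis j 1)) has_real_derivative
      partial j (partial i f) ((x + s *\<^sub>R axis i 1) + t *\<^sub>R axis j 1)) (at t)"
    if "0 \<le> t" "t \<le> h" for t
    using sub[of s t] that s by (intro has_real_derivative_line d2) auto
  obtain t where t: "0 < t" "t < h" and eq2:
    "partial i f ((x + s *\<^sub>R axis i 1) + h *\<^sub>R axis j 1) - partial i f ((x + s *\<^sub>R axis i 1) + 0 *\<^sub>R axis j 1)
     = h * partial j (partial i f) ((x + s *\<^sub>R axis i 1) + t *\<^sub>R axis j 1)"
    using MVT2[OF h G] by auto
  show thesis
    using that[OF s t] eq1 eq2 by (simp add: F_def algebra_simps power2_eq_square)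
qed

text \<open>The second difference is symmetric in the two directions, so the two mixed derivatives
  agree at two suitable points of one small square; continuity compares these values with those at
  \<open>x\<close>.\<close>

lemma partial_commute:
  assumes S: "open S" "x \<in> S" and C: "C_k_on 2 S f"
  shows "partial i (partial j f) x = partial j (partial i f) x"
proof (rule ccontr)
  let ?P = "partial i (partial j f)" and ?Q = "partial j (partial i f)"
  assume "?P x \<noteq> ?Q x"
  \<comment> \<open>Half the gap: two errors below \<open>e\<close> add up to less than the gap
    itself.\<close>
  define e where "e = \<bar>?P x - ?Q x\<bar> / 2"
  have e: "e > 0" using \<open>?P x \<noteq> ?Q x\<close> by (simp add: e_def)
  have "continuous_on S ?P" "continuous_on S ?Q" using C by (auto simp: numeral_2_eq_2)
  then have "isCont ?P x" "isCont ?Q x" using S by (simp_all add: continuous_on_eq_continuous_at)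
  then obtain d1 d2 where d1: "d1 > 0" "\<And>y. dist y x < d1 \<Longrightarrow> dist (?P y) (?P x) < e"
    and d2: "d2 > 0" "\<And>y. dist y x < d2 \<Longrightarrow> dist (?Q y) (?Q x) < e"
    using e by (fastforce simp: continuous_at_eps_delta)
  obtain d3 where d3: "d3 > 0" "\<And>y. dist y x < d3 \<Longrightarrow> y \<in> S"
    using S by (meson open_dist)
  define d where "d = min d1 (min d2 d3)"
  have d: "d > 0" using d1 d2 d3 by (simp add: d_def)
  \<comment> \<open>Two displacements of length at most \<open>h\<close> stay within two thirds of
    \<open>d\<close>.\<close>
  define h where "h = d / 3"
  have h: "h > 0" using d by (simp add: h_def)
  have near: "dist (x + s *\<^sub>R axis k 1 + t *\<^sub>R axis l 1) x < d"
    if "0 \<le> s" "s \<le> h" "0 \<le> t" "t \<le> h" for s t and k l :: 'a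
  proof -
    have "norm (s *\<^sub>R axis k 1 + t *\<^sub>R axis l (1::real)) \<le> s + t"
      using norm_triangle_ineq[of "s *\<^sub>R axis k (1::real)" "t *\<^sub>R axis l (1::real)"] that by simp
    also have "\<dots> < d" using that d by (simp add: h_def)
    finally show ?thesis by (simp add: dist_norm add.assoc)
  qed
  obtain s t where st: "0 < s" "s < h" "0 < t" "t < h"
    "f (x + h *\<^sub>R axis i 1 + h *\<^sub>R axis j 1) - f (x + h *\<^sub>R axis i 1)
       - f (x + h *\<^sub>R axis j 1) + f x = h\<^sup>2 * ?Q (x + s *\<^sub>R axis i 1 + t *\<^sub>R axis j 1)"
    by (rule second_difference[OF C h, of x i j]) (use near d3 in \<open>auto simp: d_def\<close>)
  obtain s' t' where st': "0 < s'" "s' < h" "0 < t'" "t' < h"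
    "f (x + h *\<^sub>R axis j 1 + h *\<^sub>R axis i 1) - f (x + h *\<^sub>R axis j 1)
       - f (x + h *\<^sub>R axis i 1) + f x = h\<^sup>2 * ?P (x + s' *\<^sub>R axis j 1 + t' *\<^sub>R axis i 1)"
    by (rule second_difference[OF C h, of x j i]) (use near d3 in \<open>auto simp: d_def\<close>)
  have "h\<^sup>2 * ?Q (x + s *\<^sub>R axis i 1 + t *\<^sub>R axis j 1) = h\<^sup>2 * ?P (x + s' *\<^sub>R axis j 1 + t' *\<^sub>R axis i 1)"
    using st(5) st'(5) by (simp add: algebra_simps)
  then have "?Q (x + s *\<^sub>R axis i 1 + t *\<^sub>R axis j 1) = ?P (x + s' *\<^sub>R axis j 1 + t' *\<^sub>R axis i 1)"
    using h by simp
  moreover have "dist (?Q (x + s *\<^sub>R axis i 1 + t *\<^sub>R axis j 1)) (?Q x) < e"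
    using near[of s t i j] st d2 by (simp add: d_def)
  moreover have "dist (?P (x + s' *\<^sub>R axis j 1 + t' *\<^sub>R axis i 1)) (?P x) < e"
    using near[of s' t' j i] st' d1 by (simp add: d_def)
  ultimately have "dist (?P x) (?Q x) < e + e"
    by (metis dist_commute dist_triangle_less_add)
  then show False by (simp add: e_def dist_real_def)
qed

section \<open>Calculus in a chart\<close>

locale chart =
  fixes c :: "('p::topological_space, 'n::finite) chart"
  assumes open_dom: "open (chart_dom c)"
    and open_image: "open (coord c ` chart_dom c)"
    and homeo: "homeomorphism (chart_dom c) (coord c ` chart_dom c) (coord c) (param c)"
begin

lemma param_coord [simp]: "p \<in> chart_dom c \<Longrightarrow> param c (coord c p) = p"
  using homeo by (auto simp: homeomorphism_def)

lemma param_in_dom: "x \<in> coord c ` chart_dom c \<Longrightarrow> param c x \<in> chart_dom c"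
  using homeo by (auto simp: homeomorphism_def)

lemma coord_param [simp]: "x \<in> coord c ` chart_dom c \<Longrightarrow> coord c (param c x) = x"
  using homeo by (auto simp: homeomorphism_def)

lemma open_coord_image:
  assumes "open V" "V \<subseteq> chart_dom c"
  shows "open (coord c ` V)"
proof -
  have "openin (top_of_set (coord c ` chart_dom c)) (coord c ` V)"
    using homeomorphism_imp_open_map[OF homeo, of V] assms by (simp add: openin_open_eq open_dom)
  then show ?thesis using open_image by (simp add: openin_open_eq)
qed

lemma pd_cong:
  assumes "open V" "p \<in> V" "p \<in> chart_dom c" "\<And>q. q \<in> V \<Longrightarrow> q \<in> chart_dom c \<Longrightarrow> f q = h q"
  shows "pd c i f p = pd c i h p"
  unfolding pd_def
  by (rule partial_cong[of "coord c ` (V \<inter> chart_dom c)"])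
    (use assms open_dom open_coord_image[of "V \<inter> chart_dom c"] in auto)

lemma smooth_in_cong:
  assumes "\<And>q. q \<in> chart_dom c \<Longrightarrow> f q = h q" "smooth_in c f"
  shows "smooth_in c h"
  using assms C_k_on_cong[OF open_image, of "f \<circ> param c" "h \<circ> param c"] param_in_dom
  by (auto simp: smooth_in_def smooth_on_def)

lemma smooth_in_const [simp]: "smooth_in c (\<lambda>q. k)"
  by (simp add: smooth_in_def smooth_on_def comp_def)

lemma smooth_in_add [simp]:
  "smooth_in c f \<Longrightarrow> smooth_in c h \<Longrightarrow> smooth_in c (\<lambda>q. f q + h q)"
  using C_k_on_add[OF open_image] by (fastforce simp: smooth_in_def smooth_on_def comp_def)

lemma smooth_in_mult [simp]:
  "smooth_in c f \<Longrightarrow> smooth_in c h \<Longrightarrow> smooth_in c (\<lambda>q. f q * h q)"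
  using C_k_on_mult[OF open_image] by (fastforce simp: smooth_in_def smooth_on_def comp_def)

lemma smooth_in_minus [simp]: "smooth_in c f \<Longrightarrow> smooth_in c (\<lambda>q. - f q)"
  using smooth_in_mult[of "\<lambda>q. -1" f] by simp

lemma smooth_in_diff [simp]:
  "smooth_in c f \<Longrightarrow> smooth_in c h \<Longrightarrow> smooth_in c (\<lambda>q. f q - h q)"
  using smooth_in_add[of f "\<lambda>q. - h q"] by simp

lemma smooth_in_divide_const [simp]: "smooth_in c f \<Longrightarrow> smooth_in c (\<lambda>q. f q / k)"
  using smooth_in_mult[of f "\<lambda>q. 1 / k"] by simp

lemma smooth_in_sum [simp]:
  "(\<And>i. i \<in> I \<Longrightarrow> smooth_in c (f i)) \<Longrightarrow> smooth_in c (\<lambda>q. \<Sum>i\<in>I. f i q)"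
  by (induction I rule: infinite_finite_induct) auto

lemma smooth_in_prod:
  "(\<And>i. i \<in> I \<Longrightarrow> smooth_in c (f i)) \<Longrightarrow> smooth_in c (\<lambda>q. \<Prod>i\<in>I. f i q)"
  by (induction I rule: infinite_finite_induct) auto

lemma smooth_in_powr:
  "smooth_in c f \<Longrightarrow> (\<And>q. q \<in> chart_dom c \<Longrightarrow> f q > 0) \<Longrightarrow> smooth_in c (\<lambda>q. f q powr s)"
  using C_k_on_powr[OF open_image, of "f \<circ> param c"] param_in_dom
  by (auto simp: smooth_in_def smooth_on_def comp_def)

text \<open>\<open>f\<close> may take either sign while \<open>smooth_in_powr\<close> needs a
  positive base, so the reciprocal is written as \<open>f\<close> times the power -1 of its
  square.\<close>

lemma smooth_in_inverse:
  assumes "smooth_in c f" "\<And>q. q \<in> chart_dom c \<Longrightarrow> f q \<noteq> 0"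
  shows "smooth_in c (\<lambda>q. inverse (f q))"
proof (rule smooth_in_cong)
  show "smooth_in c (\<lambda>q. f q * (f q * f q) powr (-1))"
    using assms by (intro smooth_in_mult smooth_in_powr) (auto simp: zero_less_mult_iff neq_iff)
  show "f q * (f q * f q) powr (-1) = inverse (f q)" if "q \<in> chart_dom c" for q
    using assms(2)[OF that] by (simp add: powr_minus powr_one)
qed

lemma pd_eq_partial:
  assumes "x \<in> coord c ` chart_dom c"
  shows "pd c i f (param c x) = partial i (f \<circ> param c) x"
  using assms by (simp add: pd_def)

lemma smooth_in_pd [simp]: "smooth_in c f \<Longrightarrow> smooth_in c (pd c i f)"
proof -
  assume f: "smooth_in c f"
  have "C_k_on k (coord c ` chart_dom c) (pd c i f \<circ> param c)" for k
  proof (rule C_k_on_cong[OF open_image, where f = "partial i (f \<circ> param c)"])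
    show "C_k_on k (coord c ` chart_dom c) (partial i (f \<circ> param c))"
      using f[unfolded smooth_in_def smooth_on_def, rule_format, of "Suc k"] by auto
  qed (simp add: pd_eq_partial)
  then show ?thesis by (simp add: smooth_in_def smooth_on_def)
qed

lemma smooth_in_continuous:
  assumes "smooth_in c f"
  shows "continuous_on (chart_dom c) f"
proof -
  have "continuous_on (coord c ` chart_dom c) (f \<circ> param c)"
    using assms[unfolded smooth_in_def smooth_on_def, rule_format, of 0] by auto
  moreover have "continuous_on (chart_dom c) (coord c)"
    using homeo by (auto simp: homeomorphism_def)
  ultimately have "continuous_on (chart_dom c) ((f \<circ> param c) \<circ> coord c)"
    by (rule continuous_on_compose[rotated])
  then show ?thesis by (simp cong: continuous_on_cong_simp)
qed

end

text \<open>A pointwise companion of \<open>smooth_in\<close>: Jacobians are under control only on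
  the overlap of two charts, and the derivation rules are wanted for them there.\<close>

definition pd_differentiable :: "('p, 'n::finite) chart \<Rightarrow> ('p \<Rightarrow> real) \<Rightarrow> 'p \<Rightarrow> bool" where
  "pd_differentiable c f p \<longleftrightarrow> (f \<circ> param c) differentiable (at (coord c p))"

lemma pd_differentiable_const [simp]: "pd_differentiable c (\<lambda>q. k) p"
  by (simp add: pd_differentiable_def comp_def)

lemma pd_differentiable_mult [simp]:
  "pd_differentiable c f p \<Longrightarrow> pd_differentiable c h p \<Longrightarrow> pd_differentiable c (\<lambda>q. f q * h q) p"
  by (simp add: pd_differentiable_def comp_def)

lemma pd_differentiable_add [simp]:
  "pd_differentiable c f p \<Longrightarrow> pd_differentiable c h p \<Longrightarrow> pd_differentiable c (\<lambda>q. f q + h q) p"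
  by (simp add: pd_differentiable_def comp_def)

lemma pd_differentiable_sum [simp]:
  "(\<And>i. i \<in> I \<Longrightarrow> pd_differentiable c (f i) p) \<Longrightarrow> pd_differentiable c (\<lambda>q. \<Sum>i\<in>I. f i q) p"
  by (induction I rule: infinite_finite_induct) auto

lemma pd_const [simp]: "pd c i (\<lambda>q. k) p = 0"
  by (simp add: pd_def comp_def)

context chart
begin

lemma smooth_in_pd_differentiable [simp]:
  assumes "smooth_in c f" "p \<in> chart_dom c"
  shows "pd_differentiable c f p"
  using assms(1)[unfolded smooth_in_def smooth_on_def, rule_format, of 1] assms(2)
  by (auto simp: pd_differentiable_def)

lemma pd_commute:
  assumes "smooth_in c f" "p \<in> chart_dom c"
  shows "pd c i (pd c j f) p = pd c j (pd c i f) p"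
proof -
  have *: "pd c i (pd c j f) p = partial i (partial j (f \<circ> param c)) (coord c p)" for i j
    unfolding pd_def[of c i]
    by (rule partial_cong[OF open_image]) (use assms pd_eq_partial in auto)
  show ?thesis
    using partial_commute[OF open_image, of "coord c p" "f \<circ> param c" i j] assms
    by (auto simp: * smooth_in_def smooth_on_def)
qed

end

section \<open>Derivation rules and the chain rule between two charts\<close>

lemma pd_add:
  "pd_differentiable c f p \<Longrightarrow> pd_differentiable c h p \<Longrightarrow>
    pd c i (\<lambda>q. f q + h q) p = pd c i f p + pd c i h p"
  using partial_add[of "f \<circ> param c" "coord c p" "h \<circ> param c" i]
  by (simp add: pd_def pd_differentiable_def comp_def)

text \<open>The condition on \<open>p\<close> stands for membership in the chart domain: the product
  rule evaluates the factors at \<open>param c (coord c p)\<close>, which has to be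
  \<open>p\<close>.\<close>

lemma pd_mult:
  "pd_differentiable c f p \<Longrightarrow> pd_differentiable c h p \<Longrightarrow> p = param c (coord c p) \<Longrightarrow>
    pd c i (\<lambda>q. f q * h q) p = pd c i f p * h p + f p * pd c i h p"
  using partial_mult[of "f \<circ> param c" "coord c p" "h \<circ> param c" i]
  by (simp add: pd_def pd_differentiable_def comp_def)

lemma pd_sum:
  assumes "\<And>k. k \<in> I \<Longrightarrow> pd_differentiable c (f k) p"
  shows "pd c i (\<lambda>q. \<Sum>k\<in>I. f k q) p = (\<Sum>k\<in>I. pd c i (f k) p)"
  using assms by (induction I rule: infinite_finite_induct) (auto simp: pd_add)

lemma pd_cmult:
  assumes "pd_differentiable c f p"
  shows "pd c i (\<lambda>q. k * f q) p = k * pd c i f p"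
  using partial_mult[of "\<lambda>q. k" "coord c p" "f \<circ> param c" i] assms
  by (simp add: pd_def pd_differentiable_def comp_def)

lemma pd_minus:
  "pd_differentiable c f p \<Longrightarrow> pd c i (\<lambda>q. - f q) p = - pd c i f p"
  using pd_cmult[of c f p i "-1"] by simp

lemma pd_diff:
  assumes "pd_differentiable c f p" "pd_differentiable c h p"
  shows "pd c i (\<lambda>q. f q - h q) p = pd c i f p - pd c i h p"
  using pd_add[of c f p "\<lambda>q. -1 * h q" i] pd_cmult[of c h p i "-1"] assms
    pd_differentiable_mult[of c "\<lambda>q. -1" p h]
  by simp

text \<open>On the image of the overlap, which is open, \<open>f\<close> read in the chart
  \<open>d\<close> is \<open>f\<close> read in the chart \<open>c\<close> composed with the
  transition map \<open>T\<close>. The derivative of \<open>T\<close> along a basis vector is a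
  column of the Jacobian.\<close>

lemma pd_chain:
  assumes c: "chart c" and d: "chart d" and p: "p \<in> chart_dom c" "p \<in> chart_dom d"
    and trans: "\<And>i. pd_differentiable d (\<lambda>q. coord c q $ i) p"
    and f: "pd_differentiable c f p"
  shows "pd_differentiable d f p" "pd d k f p = (\<Sum>i\<in>UNIV. jac c d p i k * pd c i f p)"
proof -
  interpret c: chart c by fact
  interpret d: chart d by fact
  let ?y = "coord d p" and ?T = "\<lambda>y. coord c (param d y)"
  let ?J = "\<lambda>i. frechet_derivative (\<lambda>y. ?T y $ i) (at ?y)"
  let ?F = "frechet_derivative (f \<circ> param c) (at (coord c p))"
  have J: "((\<lambda>y. ?T y $ i) has_derivative ?J i) (at ?y)" for i
    using trans[of i] by (simp add: pd_differentiable_def comp_def frechet_derivative_works)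
  have T: "(?T has_derivative (\<lambda>h. \<chi> i. ?J i h)) (at ?y)"
    unfolding has_derivative_componentwise_within[of ?T]
    using J by (auto simp: Basis_vec_def inner_axis)
  have F: "(f \<circ> param c has_derivative ?F) (at (?T ?y))"
    using f p by (simp add: pd_differentiable_def frechet_derivative_works)
  have comp: "((\<lambda>y. (f \<circ> param c) (?T y)) has_derivative (\<lambda>h. ?F (\<chi> i. ?J i h))) (at ?y)"
    by (rule has_derivative_compose[OF T F])
  let ?S = "coord d ` (chart_dom c \<inter> chart_dom d)"
  have S: "open ?S" "?y \<in> ?S"
    using p c.open_dom d.open_dom by (auto intro!: d.open_coord_image)
  have eq: "(f \<circ> param c) (?T y) = (f \<circ> param d) y" if "y \<in> ?S" for y
    using that by auto
  have D: "(f \<circ> param d has_derivative (\<lambda>h. ?F (\<chi> i. ?J i h))) (at ?y)"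
    using has_derivative_transform_within_open[OF comp S] eq by blast
  then show "pd_differentiable d f p" by (auto simp: pd_differentiable_def differentiable_def)
  have lin: "linear ?F" using F has_derivative_linear by blast
  have "(\<chi> i. ?J i (axis k 1)) = (\<Sum>i\<in>UNIV. jac c d p i k *\<^sub>R axis i (1::real))"
    by (simp add: vec_eq_iff jac_def pd_def partial_def comp_def axis_def if_distrib
        cong: if_cong)
  then have "pd d k f p = ?F (\<Sum>i\<in>UNIV. jac c d p i k *\<^sub>R axis i (1::real))"
    using has_derivative_partial[OF D] by (simp add: pd_def)
  also have "\<dots> = (\<Sum>i\<in>UNIV. jac c d p i k * ?F (axis i 1))"
    using lin by (simp add: linear_sum linear_scale)
  finally show "pd d k f p = (\<Sum>i\<in>UNIV. jac c d p i k * pd c i f p)"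
    by (simp add: pd_def partial_def)
qed

section \<open>The metric and its connection\<close>

lemma matrix_mul_add_right: "(B + C) ** A = B ** A + (C :: 'a::ring_1^'p^'n) ** A"
  by (simp add: matrix_matrix_mult_def vec_eq_iff distrib_right sum.distrib)

lemma matrix_mul_diff_left: "A ** (B - C) = A ** B - A ** (C :: 'a::ring_1^'p^'n)"
  by (simp add: matrix_matrix_mult_def vec_eq_iff right_diff_distrib sum_subtractf)

lemma matrix_mul_diff_right: "(B - C) ** A = B ** A - (C :: 'a::ring_1^'p^'n) ** A"
  by (simp add: matrix_matrix_mult_def vec_eq_iff left_diff_distrib sum_subtractf)

lemma transpose_add: "transpose (A + B) = transpose A + transpose B"
  by (simp add: transpose_def vec_eq_iff)

lemma transpose_diff: "transpose (A - B) = transpose A - transpose B"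
  by (simp add: transpose_def vec_eq_iff)

lemmas matrix_ring_simps = matrix_add_ldistrib matrix_mul_add_right matrix_mul_diff_left
  matrix_mul_diff_right matrix_mul_assoc transpose_add transpose_diff matrix_transpose_mul

lemma matrix_inv_inverse:
  assumes "invertible A"
  shows "A ** matrix_inv A = mat 1" "matrix_inv A ** A = mat 1"
  using someI_ex[OF assms[unfolded invertible_def]] by (simp_all add: matrix_inv_def)

text \<open>Cramer's rule for each column of the inverse. It exhibits the entries as quotients of
  determinants, which is the source of the smoothness of \<open>ginv\<close>.\<close>

lemma matrix_inv_cramer:
  fixes A :: "real^'n^'n"
  assumes "invertible A"
  shows "matrix_inv A $ k $ l =
    det (\<chi> i j. if j = k then kron i l else A $ i $ j) / det A"
proof -
  have "A *v (matrix_inv A *v axis l 1) = axis l 1"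
    using matrix_inv_inverse[OF assms] by (simp add: matrix_vector_mul_assoc)
  moreover have "det A \<noteq> 0" using assms by (simp add: invertible_det_nz)
  ultimately have "matrix_inv A *v axis l 1
      = (\<chi> k. det (\<chi> i j. if j = k then axis l 1 $ i else A $ i $ j) / det A)"
    using cramer by blast
  moreover have "axis l (1::real) $ i = kron i l" for i
    by (simp add: axis_def kron_def)
  ultimately have "(matrix_inv A *v axis l 1) $ k = det (\<chi> i j. if j = k then kron i l else A $ i $ j) / det A"
    by (simp only: vec_lambda_beta)
  then show ?thesis by (simp add: matrix_vector_mult_basis column_def)
qed

lemma sum_kron [simp]:
  "(\<Sum>r\<in>UNIV. kron i r * f r) = f (i :: 'n::finite)"
  "(\<Sum>r\<in>UNIV. kron r i * f r) = f (i :: 'n::finite)"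
  "(\<Sum>r\<in>UNIV. f r * kron i r) = f (i :: 'n::finite)"
  "(\<Sum>r\<in>UNIV. f r * kron r i) = f (i :: 'n::finite)"
  by (simp_all add: kron_def if_distrib if_distribR cong: if_cong)

locale metric_chart = chart c for c :: "('p::topological_space, 'n::finite) chart" +
  fixes g :: "('p, 'n) metric"
  assumes smooth_metric [simp]: "smooth_in c (\<lambda>p. g c p $ k $ l)"
    and metric_transpose: "p \<in> chart_dom c \<Longrightarrow> transpose (g c p) = g c p"
    and metric_pos: "p \<in> chart_dom c \<Longrightarrow> v \<noteq> 0 \<Longrightarrow> v \<bullet> (g c p *v v) > 0"
begin

lemma metric_sym: "p \<in> chart_dom c \<Longrightarrow> g c p $ i $ j = g c p $ j $ i"
  using arg_cong[OF metric_transpose, of p "\<lambda>A. A $ j $ i"] by (simp add: transpose_def)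

lemma metric_invertible: "p \<in> chart_dom c \<Longrightarrow> invertible (g c p)"
  using metric_pos by (force simp: invertible_left_inverse matrix_left_invertible_ker)

lemma ginv_metric:
  assumes "p \<in> chart_dom c"
  shows "(\<Sum>r\<in>UNIV. ginv g c p i r * g c p $ r $ j) = kron i j"
    "(\<Sum>r\<in>UNIV. g c p $ i $ r * ginv g c p r j) = kron i j"
  using arg_cong[OF matrix_inv_inverse(1)[OF metric_invertible[OF assms]], of "\<lambda>A. A $ i $ j"]
    arg_cong[OF matrix_inv_inverse(2)[OF metric_invertible[OF assms]], of "\<lambda>A. A $ i $ j"]
  by (simp_all add: matrix_matrix_mult_def ginv_def mat_def kron_def)

lemma ginv_sym:
  assumes "p \<in> chart_dom c"
  shows "ginv g c p i j = ginv g c p j i"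
proof -
  let ?I = "matrix_inv (g c p)"
  have "transpose ?I = ?I ** g c p ** transpose ?I"
    using matrix_inv_inverse(2)[OF metric_invertible[OF assms]] by simp
  also have "\<dots> = ?I ** transpose (?I ** g c p)"
    by (simp add: matrix_transpose_mul metric_transpose[OF assms] matrix_mul_assoc)
  also have "\<dots> = ?I"
    using matrix_inv_inverse(2)[OF metric_invertible[OF assms]] by simp
  finally have "transpose ?I = ?I" .
  from arg_cong[OF this, of "\<lambda>A. A $ j $ i"] show ?thesis
    by (simp add: ginv_def transpose_def)
qed

lemma smooth_in_if:
  "smooth_in c f \<Longrightarrow> smooth_in c h \<Longrightarrow> smooth_in c (\<lambda>q. if P then f q else h q)"
  by (cases P) auto

lemma smooth_det:
  assumes "\<And>i j. smooth_in c (\<lambda>p. A p i j)"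
  shows "smooth_in c (\<lambda>p. det (\<chi> i j. A p i j))"
  unfolding det_def by (auto intro!: smooth_in_sum smooth_in_mult smooth_in_prod assms)

lemma smooth_ginv [simp]: "smooth_in c (\<lambda>p. ginv g c p i j)"
proof (rule smooth_in_cong)
  show "smooth_in c (\<lambda>p. det (\<chi> k l. if l = i then kron k j else g c p $ k $ l) *
      inverse (det (\<chi> k l. g c p $ k $ l)))"
    using metric_invertible
    by (intro smooth_in_mult smooth_in_inverse smooth_det smooth_in_if) (auto simp: invertible_det_nz)
  show "det (\<chi> k l. if l = i then kron k j else g c p $ k $ l) *
      inverse (det (\<chi> k l. g c p $ k $ l)) = ginv g c p i j" if "p \<in> chart_dom c" for p
    using matrix_inv_cramer[OF metric_invertible[OF that], of i j]
    by (simp add: ginv_def divide_inverse)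
qed

lemma smooth_christoffel [simp]: "smooth_in c (\<lambda>p. christoffel g c p m i j)"
  unfolding christoffel_def by simp

lemma christoffel_sym:
  "p \<in> chart_dom c \<Longrightarrow> christoffel g c p m i j = christoffel g c p m j i"
  unfolding christoffel_def
  using pd_cong[OF open_dom, of p "\<lambda>q. g c q $ i $ j" "\<lambda>q. g c q $ j $ i"] metric_sym
  by (simp add: algebra_simps)

lemma pd_mult_smooth:
  "smooth_in c f \<Longrightarrow> smooth_in c h \<Longrightarrow> p \<in> chart_dom c \<Longrightarrow>
    pd c i (\<lambda>q. f q * h q) p = pd c i f p * h p + f p * pd c i h p"
  by (simp add: pd_mult)

lemma pd_metric_sym:
  "p \<in> chart_dom c \<Longrightarrow> pd c k (\<lambda>q. g c q $ i $ j) p = pd c k (\<lambda>q. g c q $ j $ i) p"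
  using pd_cong[OF open_dom, of p "\<lambda>q. g c q $ i $ j" "\<lambda>q. g c q $ j $ i"] metric_sym by simp

text \<open>These are the Christoffel symbols of the first kind. The inverse metric has cancelled,
  so the result is linear in the first derivatives of \<open>g\<close>.\<close>

lemma christoffel_lower:
  assumes "p \<in> chart_dom c"
  shows "(\<Sum>m\<in>UNIV. g c p $ s $ m * christoffel g c p m i j) =
    (pd c i (\<lambda>q. g c q $ s $ j) p + pd c j (\<lambda>q. g c q $ s $ i) p
      - pd c s (\<lambda>q. g c q $ i $ j) p) / 2"
proof -
  let ?K = "\<lambda>r. (pd c i (\<lambda>q. g c q $ r $ j) p + pd c j (\<lambda>q. g c q $ r $ i) p
      - pd c r (\<lambda>q. g c q $ i $ j) p) / 2"
  have "(\<Sum>m\<in>UNIV. g c p $ s $ m * christoffel g c p m i j)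
      = (\<Sum>m\<in>UNIV. \<Sum>r\<in>UNIV. g c p $ s $ m * ginv g c p m r * ?K r)"
    by (simp add: christoffel_def sum_distrib_left mult.assoc)
  also have "\<dots> = (\<Sum>r\<in>UNIV. (\<Sum>m\<in>UNIV. g c p $ s $ m * ginv g c p m r) * ?K r)"
    by (subst sum.swap) (simp only: sum_distrib_right)
  also have "\<dots> = ?K s" by (simp only: ginv_metric[OF assms] sum_kron)
  finally show ?thesis .
qed

text \<open>This is \<nabla>g = 0. In the sum of two symbols of the first kind the derivatives in
  the directions \<open>i\<close> and \<open>j\<close> cancel, and the one in direction
  \<open>k\<close> appears twice with weight 1/2.\<close>

lemma metric_compatible:
  assumes "p \<in> chart_dom c"
  shows "pd c k (\<lambda>q. g c q $ i $ j) p =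
    (\<Sum>m\<in>UNIV. christoffel g c p m k i * g c p $ m $ j)
    + (\<Sum>m\<in>UNIV. christoffel g c p m k j * g c p $ i $ m)"
proof -
  have "(\<Sum>m\<in>UNIV. christoffel g c p m k i * g c p $ m $ j)
      = (\<Sum>m\<in>UNIV. g c p $ j $ m * christoffel g c p m k i)"
    by (rule sum.cong) (use metric_sym[OF assms, of _ j] in simp_all)
  then have "(\<Sum>m\<in>UNIV. christoffel g c p m k i * g c p $ m $ j)
    + (\<Sum>m\<in>UNIV. christoffel g c p m k j * g c p $ i $ m)
    = (\<Sum>m\<in>UNIV. g c p $ j $ m * christoffel g c p m k i)
    + (\<Sum>m\<in>UNIV. g c p $ i $ m * christoffel g c p m k j)"
    by (simp only: mult.commute)
  then show ?thesis
    using pd_metric_sym[OF assms, of k j i] pd_metric_sym[OF assms, of i j k]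
      pd_metric_sym[OF assms, of j k i]
    by (simp only: christoffel_lower[OF assms]) (simp add: field_simps)
qed

text \<open>The inverse metric is parallel: differentiate the constant product of
  \<open>ginv\<close> and \<open>g\<close>, insert metric compatibility as \<open>Q\<close>, and
  multiply by the inverse \<open>I\<close> from the right.\<close>

lemma pd_ginv:
  assumes "p \<in> chart_dom c"
  shows "pd c k (\<lambda>q. ginv g c q i j) p =
    - (\<Sum>m\<in>UNIV. christoffel g c p i k m * ginv g c p m j)
    - (\<Sum>m\<in>UNIV. christoffel g c p j k m * ginv g c p i m)"
proof -
  define I where "I = matrix_inv (g c p)"
  define Q where "Q = (\<chi> i j. pd c k (\<lambda>q. g c q $ i $ j) p)"
  define N where "N = (\<chi> i j. pd c k (\<lambda>q. ginv g c q i j) p)"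
  define E where "E = (\<chi> m l. christoffel g c p m k l)"
  have Q: "Q = transpose E ** g c p + g c p ** E"
    using assms by (simp add: vec_eq_iff Q_def E_def metric_compatible matrix_matrix_mult_def
        transpose_def mult.commute)
  have inv: "I ** g c p = mat 1" "g c p ** I = mat 1"
    using matrix_inv_inverse[OF metric_invertible[OF assms]] by (simp_all add: I_def)
  have "pd c k (\<lambda>q. \<Sum>r\<in>UNIV. ginv g c q i r * g c q $ r $ j) p = 0" for i j
    using pd_cong[OF open_dom assms assms, of "\<lambda>q. \<Sum>r\<in>UNIV. ginv g c q i r * g c q $ r $ j"
        "\<lambda>q. kron i j"] ginv_metric(1) by simp
  then have eq: "N ** g c p + I ** Q = 0"
    using assms by (simp add: vec_eq_iff N_def Q_def I_def matrix_matrix_mult_def pd_sum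
        pd_mult_smooth sum.distrib flip: ginv_def)
  have "N ** (g c p ** I) + I ** transpose E ** (g c p ** I) + (I ** g c p) ** E ** I = 0"
    using arg_cong[OF eq, of "\<lambda>A. A ** I"] by (simp add: Q matrix_ring_simps algebra_simps)
  then have "N = - (E ** I) - I ** transpose E"
    by (simp add: inv eq_neg_iff_add_eq_0 algebra_simps)
  from arg_cong[OF this, of "\<lambda>A. A $ i $ j"] show ?thesis
    by (simp add: N_def E_def I_def matrix_matrix_mult_def transpose_def mult.commute
        flip: ginv_def)
qed

end

section \<open>Curvature and the Bianchi identities\<close>

text \<open>The connection matrices \<open>\<Gamma>\<^sub>k\<close> have row index \<open>m\<close> and column index \<open>l\<close>; in these terms the
  curvature is \<open>\<partial>\<^sub>k \<Gamma>\<^sub>j - \<partial>\<^sub>j \<Gamma>\<^sub>k + [\<Gamma>\<^sub>k, \<Gamma>\<^sub>j]\<close>.\<close>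

definition conn ::
    "('p, 'n::finite) metric \<Rightarrow> ('p, 'n) chart \<Rightarrow> 'p \<Rightarrow> 'n \<Rightarrow> real^'n^'n" where
  "conn g c p k = (\<chi> m l. christoffel g c p m k l)"

definition dconn ::
    "('p, 'n::finite) metric \<Rightarrow> ('p, 'n) chart \<Rightarrow> 'p \<Rightarrow> 'n \<Rightarrow> 'n \<Rightarrow> real^'n^'n" where
  "dconn g c p i k = (\<chi> m l. pd c i (\<lambda>q. christoffel g c q m k l) p)"

definition ddconn ::
    "('p, 'n::finite) metric \<Rightarrow> ('p, 'n) chart \<Rightarrow> 'p \<Rightarrow> 'n \<Rightarrow> 'n \<Rightarrow> 'n \<Rightarrow> real^'n^'n" where
  "ddconn g c p h i k = (\<chi> m l. pd c h (pd c i (\<lambda>q. christoffel g c q m k l)) p)"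

definition curv ::
    "('p, 'n::finite) metric \<Rightarrow> ('p, 'n) chart \<Rightarrow> 'p \<Rightarrow> 'n \<Rightarrow> 'n \<Rightarrow> real^'n^'n" where
  "curv g c p j k = dconn g c p k j - dconn g c p j k
     + conn g c p k ** conn g c p j - conn g c p j ** conn g c p k"

lemma riemann_curv: "riemann g c p j k l m = curv g c p j k $ m $ l"
  by (simp add: riemann_def curv_def conn_def dconn_def matrix_matrix_mult_def sum_subtractf)

lemma riemann_antisym: "riemann g c p j k l m = - riemann g c p k j l m"
  by (simp add: riemann_curv curv_def)

context metric_chart
begin

lemma ddconn_sym: "p \<in> chart_dom c \<Longrightarrow> ddconn g c p h i k = ddconn g c p i h k"
  using pd_commute by (simp add: ddconn_def)

lemma smooth_riemann [simp]: "smooth_in c (\<lambda>p. riemann g c p j k l m)"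
  unfolding riemann_def by simp

lemma smooth_ricci [simp]: "smooth_in c (\<lambda>p. ricci g c p k l)"
  unfolding ricci_def by simp

lemma smooth_ricci_mixed [simp]: "smooth_in c (\<lambda>p. ricci_mixed g c p k l)"
  unfolding ricci_mixed_def by simp

lemma smooth_scalar_curv [simp]: "smooth_in c (\<lambda>p. scalar_curv g c p)"
  unfolding scalar_curv_def by simp

text \<open>The curvature is skew with respect to \<open>g\<close>. Differentiating metric
  compatibility once more gives the second derivatives of \<open>g\<close>; in their commutator the
  products with \<open>g\<close> in the middle are symmetric in \<open>j\<close> and
  \<open>k\<close> and drop out, and the rest is the curvature.\<close>

lemma curv_metric:
  assumes p: "p \<in> chart_dom c"
  shows "transpose (curv g c p j k) ** g c p + g c p ** curv g c p j k = 0"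
proof -
  define M where "M = conn g c p"
  define N where "N = dconn g c p"
  define Q where "Q k = (\<chi> i j. pd c k (\<lambda>q. g c q $ i $ j) p)" for k
  have Q: "Q k = transpose (M k) ** g c p + g c p ** M k" for k
    using p by (simp add: vec_eq_iff Q_def M_def conn_def metric_compatible matrix_matrix_mult_def
        transpose_def mult.commute)
  have QQ: "(\<chi> l s. pd c j (pd c k (\<lambda>q. g c q $ l $ s)) p)
    = transpose (N j k) ** g c p + transpose (M k) ** Q j + Q j ** M k + g c p ** N j k" for j k
  proof -
    have "pd c j (pd c k (\<lambda>q. g c q $ l $ s)) p
      = pd c j (\<lambda>p. (\<Sum>m\<in>UNIV. christoffel g c p m k l * g c p $ m $ s)
        + (\<Sum>m\<in>UNIV. christoffel g c p m k s * g c p $ l $ m)) p" for l s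
      by (rule pd_cong[OF open_dom p p]) (simp add: metric_compatible)
    then show ?thesis
      using p by (simp add: vec_eq_iff M_def N_def Q_def conn_def dconn_def matrix_matrix_mult_def
          transpose_def pd_add pd_sum pd_mult_smooth sum.distrib mult.commute)
  qed
  have "(\<chi> l s. pd c j (pd c k (\<lambda>q. g c q $ l $ s)) p) = (\<chi> l s. pd c k (pd c j (\<lambda>q. g c q $ l $ s)) p)"
    using pd_commute p by (simp add: vec_eq_iff)
  then show ?thesis
    unfolding QQ Q curv_def M_def[symmetric] N_def[symmetric]
    by (simp add: matrix_ring_simps algebra_simps)
qed

lemma riemann_upper_antisym:
  assumes p: "p \<in> chart_dom c"
  shows "(\<Sum>l\<in>UNIV. ginv g c p s l * riemann g c p j k l m)
    = - (\<Sum>l\<in>UNIV. ginv g c p m l * riemann g c p j k l s)"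
proof -
  define I where "I = matrix_inv (g c p)"
  define R where "R = curv g c p j k"
  have inv: "I ** g c p = mat 1" "g c p ** I = mat 1"
    using matrix_inv_inverse[OF metric_invertible[OF p]] by (simp_all add: I_def)
  have "I ** transpose R ** (g c p ** I) + (I ** g c p) ** R ** I = 0"
    using arg_cong[OF curv_metric[OF p, of j k], of "\<lambda>A. I ** A ** I"]
    by (simp add: matrix_ring_simps R_def)
  then have "I ** transpose R + R ** I = 0" by (simp add: inv)
  from arg_cong[OF this, of "\<lambda>A. A $ s $ m"]
  have "(\<Sum>l\<in>UNIV. ginv g c p s l * riemann g c p j k l m)
    + (\<Sum>l\<in>UNIV. riemann g c p j k l s * ginv g c p l m) = 0"
    by (simp add: matrix_matrix_mult_def transpose_def riemann_curv R_def I_def ginv_def)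
  moreover have "(\<Sum>l\<in>UNIV. riemann g c p j k l s * ginv g c p l m)
      = (\<Sum>l\<in>UNIV. ginv g c p m l * riemann g c p j k l s)"
    by (rule sum.cong) (use ginv_sym[OF p, of m] in simp_all)
  ultimately show ?thesis by simp
qed

text \<open>An endomorphism that is skew with respect to \<open>g\<close> is minus a conjugate of
  its transpose, so its trace equals its own negative.\<close>

lemma riemann_trace_last:
  assumes p: "p \<in> chart_dom c"
  shows "(\<Sum>m\<in>UNIV. riemann g c p j k m m) = 0"
proof -
  let ?I = "matrix_inv (g c p)" and ?R = "curv g c p j k"
  have inv: "?I ** g c p = mat 1" "g c p ** ?I = mat 1"
    using matrix_inv_inverse[OF metric_invertible[OF p]] by simp_all
  have "?I ** (transpose ?R ** g c p) + ?R = 0"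
    using arg_cong[OF curv_metric[OF p, of j k], of "\<lambda>A. ?I ** A"]
    by (simp add: matrix_add_ldistrib matrix_mul_assoc inv)
  then have "trace (?I ** (transpose ?R ** g c p)) + trace ?R = 0"
    by (metis trace_add trace_0 mat_0)
  moreover have "trace (?I ** (transpose ?R ** g c p)) = trace (transpose ?R ** (g c p ** ?I))"
    by (subst trace_mul_sym) (simp add: matrix_mul_assoc)
  ultimately have "trace (transpose ?R) + trace ?R = 0" by (simp add: inv)
  then show ?thesis by (simp add: trace_def transpose_def riemann_curv)
qed

text \<open>Torsion-freeness: by the symmetry of the Christoffel symbols the derivative terms and
  the quadratic terms cancel in pairs over the cyclic sum.\<close>

lemma bianchi_first:
  assumes p: "p \<in> chart_dom c"
  shows "riemann g c p j k l m + riemann g c p k l j m + riemann g c p l j k m = 0"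
proof -
  have "pd c i (\<lambda>q. christoffel g c q m j l) p = pd c i (\<lambda>q. christoffel g c q m l j) p" for i j l
    by (rule pd_cong[OF open_dom p p]) (rule christoffel_sym)
  note this[of j k l] this[of k l j] this[of l j k]
  moreover have "(\<Sum>r\<in>UNIV. christoffel g c p m i r * christoffel g c p r j l)
      = (\<Sum>r\<in>UNIV. christoffel g c p m i r * christoffel g c p r l j)" for i j l
    by (simp add: christoffel_sym[OF p, of _ j l])
  note this[of j k l] this[of k l j] this[of l j k]
  ultimately show ?thesis by (simp add: riemann_def sum_subtractf)
qed

text \<open>Contract the first Bianchi identity; the middle term is the trace over the last pair,
  which vanishes.\<close>

lemma ricci_sym:
  assumes p: "p \<in> chart_dom c"
  shows "ricci g c p k l = ricci g c p l k"
proof -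
  have "(\<Sum>m\<in>UNIV. riemann g c p m k l m + riemann g c p k l m m + riemann g c p l m k m) = 0"
    using bianchi_first[OF p] by simp
  moreover have "riemann g c p l m k m = - riemann g c p m l k m" for m by (rule riemann_antisym)
  ultimately show ?thesis
    by (simp add: sum.distrib sum_subtractf riemann_trace_last[OF p] ricci_def)
qed

text \<open>With \<open>l\<close> and \<open>m\<close> as matrix indices their Christoffel terms
  form the commutator with \<open>conn g c p i\<close>; only the indices \<open>j\<close> and
  \<open>k\<close> keep explicit corrections.\<close>

lemma nabla31_riemann:
  assumes p: "p \<in> chart_dom c"
  shows "nabla31 g (riemann g) c p i j k l m =
    (ddconn g c p i k j - ddconn g c p i j k
      + dconn g c p i k ** conn g c p j + conn g c p k ** dconn g c p i j
      - dconn g c p i j ** conn g c p k - conn g c p j ** dconn g c p i k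
      + conn g c p i ** curv g c p j k - curv g c p j k ** conn g c p i) $ m $ l
    - (\<Sum>r\<in>UNIV. christoffel g c p r i j * riemann g c p r k l m)
    - (\<Sum>r\<in>UNIV. christoffel g c p r i k * riemann g c p j r l m)"
proof -
  have "pd c i (\<lambda>q. riemann g c q j k l m) p =
    (ddconn g c p i k j - ddconn g c p i j k
      + dconn g c p i k ** conn g c p j + conn g c p k ** dconn g c p i j
      - dconn g c p i j ** conn g c p k - conn g c p j ** dconn g c p i k) $ m $ l"
    unfolding riemann_def using p
    by (simp add: pd_add pd_diff pd_sum pd_mult_smooth ddconn_def dconn_def conn_def
        matrix_matrix_mult_def sum.distrib sum_subtractf)
  then show ?thesis
    by (simp add: nabla31_def riemann_curv conn_def matrix_matrix_mult_def mult.commute)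
qed

text \<open>In the cyclic sum of the matrix parts \<open>T\<close>, second derivatives cancel
  because they commute, triple products by the Jacobi identity, and products with one derivative
  against the commutators with the curvature. The corrections for the form indices cancel in pairs
  by \<open>C\<close>.\<close>

lemma bianchi_second:
  assumes p: "p \<in> chart_dom c"
  shows "nabla31 g (riemann g) c p i j k l m + nabla31 g (riemann g) c p j k i l m
    + nabla31 g (riemann g) c p k i j l m = 0"
proof -
  define T where "T i j k = ddconn g c p i k j - ddconn g c p i j k
      + dconn g c p i k ** conn g c p j + conn g c p k ** dconn g c p i j
      - dconn g c p i j ** conn g c p k - conn g c p j ** dconn g c p i k
      + conn g c p i ** curv g c p j k - curv g c p j k ** conn g c p i" for i j k
  have "T i j k + T j k i + T k i j = 0"
    unfolding T_def curv_def
    using ddconn_sym[OF p, of i j] ddconn_sym[OF p, of j k] ddconn_sym[OF p, of k i]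
    by (simp add: matrix_ring_simps algebra_simps)
  from arg_cong[OF this, of "\<lambda>A. A $ m $ l"]
  have T: "T i j k $ m $ l + T j k i $ m $ l + T k i j $ m $ l = 0" by simp
  have C: "(\<Sum>r\<in>UNIV. christoffel g c p r i j * riemann g c p r k l m)
    = - (\<Sum>r\<in>UNIV. christoffel g c p r j i * riemann g c p k r l m)" for i j k
    by (simp add: christoffel_sym[OF p, of _ i j] riemann_antisym[of g c p _ k] sum_negf)
  show ?thesis
    using T C[of i j k] C[of j k i] C[of k i j]
    unfolding nabla31_riemann[OF p] T_def[symmetric] by simp
qed

end

section \<open>Traces and divergences\<close>

text \<open>The covariant derivative for one lower and one upper index: the type of
  \<open>ricci_mixed\<close>, and the type left when a pair of lower indices of the Riemann tensor
  is traced.\<close>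

definition nabla11 ::
    "('p, 'n::finite) metric \<Rightarrow> (('p, 'n) chart \<Rightarrow> 'p \<Rightarrow> 'n \<Rightarrow> 'n \<Rightarrow> real) \<Rightarrow>
      ('p, 'n) chart \<Rightarrow> 'p \<Rightarrow> 'n \<Rightarrow> 'n \<Rightarrow> 'n \<Rightarrow> real" where
  "nabla11 g T c p i j m =
     pd c i (\<lambda>q. T c q j m) p
     - (\<Sum>r\<in>UNIV. christoffel g c p r i j * T c p r m)
     + (\<Sum>r\<in>UNIV. christoffel g c p m i r * T c p j r)"

lemma sum_swap23: "(\<Sum>i\<in>A. \<Sum>j\<in>B. \<Sum>k\<in>C. f i j k) = (\<Sum>i\<in>A. \<Sum>k\<in>C. \<Sum>j\<in>B. f i j k)"
  by (intro sum.cong refl sum.swap)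

lemma sum_swap13: "(\<Sum>i\<in>A. \<Sum>j\<in>B. \<Sum>k\<in>C. f i j k) = (\<Sum>k\<in>C. \<Sum>j\<in>B. \<Sum>i\<in>A. f i j k)"
proof -
  have "(\<Sum>i\<in>A. \<Sum>j\<in>B. \<Sum>k\<in>C. f i j k) = (\<Sum>k\<in>C. \<Sum>i\<in>A. \<Sum>j\<in>B. f i j k)"
    by (subst sum_swap23) (rule sum.swap)
  also have "\<dots> = (\<Sum>k\<in>C. \<Sum>j\<in>B. \<Sum>i\<in>A. f i j k)" by (rule sum_swap23)
  finally show ?thesis .
qed

section \<open>Linearity, product rules and contractions of covariant derivatives\<close>

context metric_chart
begin

lemma nabla2_linear:
  assumes p: "p \<in> chart_dom c"
    and A: "\<And>k l. smooth_in c (\<lambda>p. A c p k l)" and B: "\<And>k l. smooth_in c (\<lambda>p. B c p k l)"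
  shows "nabla2 g (\<lambda>c p k l. x * A c p k l + y * B c p k l) c p i k l =
    x * nabla2 g A c p i k l + y * nabla2 g B c p i k l"
  using p A B
  by (simp add: nabla2_def pd_add pd_cmult algebra_simps sum.distrib sum_distrib_left)

lemma nabla31_linear:
  assumes p: "p \<in> chart_dom c"
    and A: "\<And>j k l m. smooth_in c (\<lambda>p. A c p j k l m)"
    and B: "\<And>j k l m. smooth_in c (\<lambda>p. B c p j k l m)"
  shows "nabla31 g (\<lambda>c p j k l m. x * A c p j k l m + y * B c p j k l m) c p i j k l m =
    x * nabla31 g A c p i j k l m + y * nabla31 g B c p i j k l m"
  using p A B
  by (simp add: nabla31_def pd_add pd_cmult algebra_simps sum.distrib sum_distrib_left)

lemma nabla31_swap: "nabla31 g (\<lambda>c p j k l m. A c p k j l m) c p i j k l m = nabla31 g A c p i k j l m"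
  by (simp add: nabla31_def)

lemma nabla2_scalar_metric:
  assumes p: "p \<in> chart_dom c" and f: "smooth_in c (f c)"
  shows "nabla2 g (\<lambda>c p k l. f c p * g c p $ k $ l) c p i k l = pd c i (f c) p * g c p $ k $ l"
proof -
  have "pd c i (\<lambda>q. f c q * g c q $ k $ l) p = pd c i (f c) p * g c p $ k $ l
    + f c p * pd c i (\<lambda>q. g c q $ k $ l) p"
    using p f by (simp add: pd_mult_smooth)
  then show ?thesis
    unfolding nabla2_def metric_compatible[OF p] by (simp add: algebra_simps sum_distrib_left)
qed

text \<open>The Kronecker tensor is parallel: the corrections for its lower and its upper index
  cancel.\<close>

lemma nabla31_kron:
  assumes p: "p \<in> chart_dom c" and A: "\<And>k l. smooth_in c (\<lambda>p. A c p k l)"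
  shows "nabla31 g (\<lambda>c p j k l m. kron j m * A c p k l) c p i j k l m = kron j m * nabla2 g A c p i k l"
proof -
  have "(\<Sum>r\<in>UNIV. christoffel g c p r i j * (kron r m * A c p k l)) = christoffel g c p m i j * A c p k l"
    "(\<Sum>r\<in>UNIV. christoffel g c p m i r * (kron j r * A c p k l)) = christoffel g c p m i j * A c p k l"
    by (simp_all flip: mult.assoc sum_distrib_right)
  moreover have "pd c i (\<lambda>q. kron j m * A c q k l) p = kron j m * pd c i (\<lambda>q. A c q k l) p"
    using p A by (simp add: pd_cmult)
  ultimately show ?thesis
    by (simp add: nabla31_def nabla2_def algebra_simps sum_distrib_left)
qed

lemma nabla31_mult_metric:
  assumes p: "p \<in> chart_dom c" and A: "\<And>k l. smooth_in c (\<lambda>p. A c p k l)"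
  shows "nabla31 g (\<lambda>c p j k l m. A c p j m * g c p $ k $ l) c p i j k l m =
    nabla11 g A c p i j m * g c p $ k $ l"
proof -
  have "pd c i (\<lambda>q. A c q j m * g c q $ k $ l) p = pd c i (\<lambda>q. A c q j m) p * g c p $ k $ l
    + A c p j m * pd c i (\<lambda>q. g c q $ k $ l) p"
    using p A by (simp add: pd_mult_smooth)
  then show ?thesis
    unfolding nabla31_def nabla11_def metric_compatible[OF p]
    by (simp add: algebra_simps sum_distrib_left)
qed

text \<open>The trace commutes with differentiation because the inverse metric is parallel
  (\<open>pd_ginv\<close>); the rest is a renaming of dummy indices.\<close>

lemma nabla2_trace:
  assumes p: "p \<in> chart_dom c" and A: "\<And>k l. smooth_in c (\<lambda>p. A c p k l)"
  shows "(\<Sum>k\<in>UNIV. \<Sum>l\<in>UNIV. ginv g c p k l * nabla2 g A c p i k l) =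
    pd c i (\<lambda>q. \<Sum>k\<in>UNIV. \<Sum>l\<in>UNIV. ginv g c q k l * A c q k l) p"
proof -
  have "(\<Sum>k\<in>UNIV. \<Sum>l\<in>UNIV. \<Sum>r\<in>UNIV. ginv g c p k l * christoffel g c p r i k * A c p r l)
    = (\<Sum>k\<in>UNIV. \<Sum>l\<in>UNIV. \<Sum>r\<in>UNIV. christoffel g c p k i r * ginv g c p r l * A c p k l)"
    by (subst sum_swap13) (simp add: mult_ac)
  moreover have "(\<Sum>k\<in>UNIV. \<Sum>l\<in>UNIV. \<Sum>r\<in>UNIV. ginv g c p k l * christoffel g c p r i l * A c p k r)
    = (\<Sum>k\<in>UNIV. \<Sum>l\<in>UNIV. \<Sum>r\<in>UNIV. christoffel g c p l i r * ginv g c p k r * A c p k l)"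
    by (subst sum_swap23) (simp add: mult_ac)
  ultimately show ?thesis
    using p A
    by (simp add: nabla2_def pd_sum pd_mult_smooth pd_ginv right_diff_distrib left_diff_distrib
        sum_distrib_left sum_distrib_right sum.distrib sum_subtractf sum_negf mult.assoc)
qed

lemma nabla31_trace:
  assumes p: "p \<in> chart_dom c" and A: "\<And>j k l m. smooth_in c (\<lambda>p. A c p j k l m)"
  shows "(\<Sum>k\<in>UNIV. \<Sum>l\<in>UNIV. ginv g c p k l * nabla31 g A c p i j k l m) =
    nabla11 g (\<lambda>c p j m. \<Sum>k\<in>UNIV. \<Sum>l\<in>UNIV. ginv g c p k l * A c p j k l m) c p i j m"
proof -
  have "(\<Sum>k\<in>UNIV. \<Sum>l\<in>UNIV. \<Sum>r\<in>UNIV. ginv g c p k l * christoffel g c p r i k * A c p j r l m)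
    = (\<Sum>k\<in>UNIV. \<Sum>l\<in>UNIV. \<Sum>r\<in>UNIV. christoffel g c p k i r * ginv g c p r l * A c p j k l m)"
    by (subst sum_swap13) (simp add: mult_ac)
  moreover have "(\<Sum>k\<in>UNIV. \<Sum>l\<in>UNIV. \<Sum>r\<in>UNIV. ginv g c p k l * christoffel g c p r i l * A c p j k r m)
    = (\<Sum>k\<in>UNIV. \<Sum>l\<in>UNIV. \<Sum>r\<in>UNIV. christoffel g c p l i r * ginv g c p k r * A c p j k l m)"
    by (subst sum_swap23) (simp add: mult_ac)
  moreover have "(\<Sum>k\<in>UNIV. \<Sum>l\<in>UNIV. \<Sum>r\<in>UNIV. ginv g c p k l * christoffel g c p r i j * A c p r k l m)
    = (\<Sum>r\<in>UNIV. \<Sum>k\<in>UNIV. \<Sum>l\<in>UNIV. christoffel g c p r i j * (ginv g c p k l * A c p r k l m))"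
    by (subst sum_swap23, subst sum.swap) (simp add: mult_ac)
  moreover have "(\<Sum>k\<in>UNIV. \<Sum>l\<in>UNIV. \<Sum>r\<in>UNIV. ginv g c p k l * christoffel g c p m i r * A c p j k l r)
    = (\<Sum>r\<in>UNIV. \<Sum>k\<in>UNIV. \<Sum>l\<in>UNIV. christoffel g c p m i r * (ginv g c p k l * A c p j k l r))"
    by (subst sum_swap23, subst sum.swap) (simp add: mult_ac)
  ultimately show ?thesis
    using p A
    by (simp add: nabla31_def nabla11_def pd_sum pd_mult_smooth pd_ginv right_diff_distrib
        left_diff_distrib distrib_left distrib_right
        sum_distrib_left sum_distrib_right sum.distrib sum_subtractf sum_negf mult.assoc)
qed

lemma nabla11_raise:
  assumes p: "p \<in> chart_dom c" and A: "\<And>k l. smooth_in c (\<lambda>p. A c p k l)"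
  shows "nabla11 g (\<lambda>c p j m. \<Sum>r\<in>UNIV. ginv g c p m r * A c p j r) c p i j m =
    (\<Sum>r\<in>UNIV. ginv g c p m r * nabla2 g A c p i j r)"
proof -
  have "(\<Sum>r\<in>UNIV. \<Sum>s\<in>UNIV. ginv g c p m r * christoffel g c p s i j * A c p s r)
    = (\<Sum>s\<in>UNIV. \<Sum>r\<in>UNIV. christoffel g c p s i j * (ginv g c p m r * A c p s r))"
    by (subst sum.swap) (simp add: mult_ac)
  moreover have "(\<Sum>r\<in>UNIV. \<Sum>s\<in>UNIV. ginv g c p m r * christoffel g c p s i r * A c p j s)
    = (\<Sum>s\<in>UNIV. \<Sum>r\<in>UNIV. christoffel g c p s i r * ginv g c p m r * A c p j s)"
    by (subst sum.swap) (simp add: mult_ac)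
  moreover have "(\<Sum>r\<in>UNIV. \<Sum>s\<in>UNIV. christoffel g c p m i s * ginv g c p s r * A c p j r)
    = (\<Sum>s\<in>UNIV. \<Sum>r\<in>UNIV. christoffel g c p m i s * (ginv g c p s r * A c p j r))"
    by (subst sum.swap) (simp add: mult_ac)
  ultimately show ?thesis
    using p A
    by (simp add: nabla2_def nabla11_def pd_sum pd_mult_smooth pd_ginv right_diff_distrib
        left_diff_distrib distrib_left distrib_right
        sum_distrib_left sum_distrib_right sum.distrib sum_subtractf sum_negf mult.assoc)
qed

section \<open>Contracted Bianchi identities and the divergence of \<open>W\<close>\<close>

lemma nabla31_riemann_antisym:
  assumes p: "p \<in> chart_dom c"
  shows "nabla31 g (riemann g) c p i j k l m = - nabla31 g (riemann g) c p i k j l m"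
  using nabla31_linear[OF p, of "riemann g" "riemann g" "-1" 0 i k j l m]
    nabla31_swap[where A = "\<lambda>c p j k l m. - riemann g c p j k l m"]
  by (simp flip: riemann_antisym)

lemma nabla31_riemann_contract:
  assumes p: "p \<in> chart_dom c"
  shows "(\<Sum>m\<in>UNIV. nabla31 g (riemann g) c p i m k l m) = - nabla2 g (ricci g) c p i k l"
proof -
  let ?R = "riemann g c p"
  have "(\<Sum>m\<in>UNIV. \<Sum>r\<in>UNIV. christoffel g c p r i m * ?R r k l m)
    = (\<Sum>m\<in>UNIV. \<Sum>r\<in>UNIV. christoffel g c p m i r * ?R m k l r)"
    by (rule sum.swap)
  moreover have "(\<Sum>m\<in>UNIV. \<Sum>r\<in>UNIV. christoffel g c p r i k * ?R m r l m)
    = (\<Sum>r\<in>UNIV. christoffel g c p r i k * (\<Sum>m\<in>UNIV. ?R m r l m))"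
    by (subst sum.swap) (simp add: sum_distrib_left)
  moreover have "(\<Sum>m\<in>UNIV. \<Sum>r\<in>UNIV. christoffel g c p r i l * ?R m k r m)
    = (\<Sum>r\<in>UNIV. christoffel g c p r i l * (\<Sum>m\<in>UNIV. ?R m k r m))"
    by (subst sum.swap) (simp add: sum_distrib_left)
  moreover have "pd c i (\<lambda>q. ricci g c q k l) p = - (\<Sum>m\<in>UNIV. pd c i (\<lambda>q. riemann g c q m k l m) p)"
    unfolding ricci_def using p by (simp add: pd_minus pd_sum)
  ultimately show ?thesis
    by (simp add: nabla31_def nabla2_def sum.distrib sum_subtractf ricci_def sum_negf)
qed

lemma bianchi_contracted:
  assumes p: "p \<in> chart_dom c"
  shows "(\<Sum>m\<in>UNIV. nabla31 g (riemann g) c p m j k l m)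
    = nabla2 g (ricci g) c p k j l - nabla2 g (ricci g) c p j k l"
proof -
  have "(\<Sum>m\<in>UNIV. nabla31 g (riemann g) c p m j k l m + nabla31 g (riemann g) c p j k m l m
      + nabla31 g (riemann g) c p k m j l m) = 0"
    using bianchi_second[OF p] by simp
  moreover have "nabla31 g (riemann g) c p j k m l m = - nabla31 g (riemann g) c p j m k l m" for m
    by (rule nabla31_riemann_antisym[OF p])
  ultimately show ?thesis
    by (simp add: sum.distrib sum_subtractf nabla31_riemann_contract[OF p])
qed

lemma nabla11_cong:
  assumes "p \<in> chart_dom c" "\<And>q j m. q \<in> chart_dom c \<Longrightarrow> A c q j m = B c q j m"
  shows "nabla11 g A c p i j m = nabla11 g B c p i j m"
  using pd_cong[OF open_dom, of p "\<lambda>q. A c q j m" "\<lambda>q. B c q j m"] assms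
  by (simp add: nabla11_def)

text \<open>Two antisymmetries, in the raised last pair and in the first pair, move the contraction
  to the slots in which \<open>ricci\<close> is defined.\<close>

lemma riemann_trace_middle:
  assumes p: "p \<in> chart_dom c"
  shows "(\<Sum>k\<in>UNIV. \<Sum>l\<in>UNIV. ginv g c p k l * riemann g c p j k l m)
    = (\<Sum>r\<in>UNIV. ginv g c p m r * - ricci g c p j r)"
proof -
  have "(\<Sum>k\<in>UNIV. \<Sum>l\<in>UNIV. ginv g c p k l * riemann g c p j k l m)
    = (\<Sum>k\<in>UNIV. - (\<Sum>l\<in>UNIV. ginv g c p m l * riemann g c p j k l k))"
    by (simp only: riemann_upper_antisym[OF p, of _ j _ m])
  also have "\<dots> = (\<Sum>k\<in>UNIV. \<Sum>l\<in>UNIV. ginv g c p m l * riemann g c p k j l k)"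
    by (simp add: riemann_antisym[of g c p j] sum_negf)
  also have "\<dots> = (\<Sum>r\<in>UNIV. ginv g c p m r * - ricci g c p j r)"
    by (subst sum.swap) (simp add: ricci_def sum_distrib_left)
  finally show ?thesis .
qed

text \<open>Trace \<open>bianchi_contracted\<close> over \<open>k\<close> and \<open>l\<close>. With
  \<open>X\<close> the divergence of the Ricci tensor, one side becomes \<open>- X\<close> and the
  other \<open>X\<close> minus the gradient of the scalar curvature.\<close>

lemma ricci_divergence:
  assumes p: "p \<in> chart_dom c"
  shows "(\<Sum>m\<in>UNIV. \<Sum>r\<in>UNIV. ginv g c p m r * nabla2 g (ricci g) c p m j r)
    = pd c j (scalar_curv g c) p / 2"
proof -
  let ?N = "nabla2 g (ricci g) c p" and ?H = "ginv g c p"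
  have minus: "nabla2 g (\<lambda>c p k l. - ricci g c p k l) c p i j r = - ?N i j r" for i j r
    using nabla2_linear[OF p, of "ricci g" "ricci g" "-1" 0] by simp
  have "(\<Sum>k\<in>UNIV. \<Sum>l\<in>UNIV. ?H k l * (\<Sum>m\<in>UNIV. nabla31 g (riemann g) c p m j k l m))
    = (\<Sum>m\<in>UNIV. \<Sum>k\<in>UNIV. \<Sum>l\<in>UNIV. ?H k l * nabla31 g (riemann g) c p m j k l m)"
    by (simp add: sum_distrib_left) (subst sum_swap23, rule sum.swap)
  also have "\<dots> = (\<Sum>m\<in>UNIV. nabla11 g
      (\<lambda>c p j m. \<Sum>k\<in>UNIV. \<Sum>l\<in>UNIV. ginv g c p k l * riemann g c p j k l m) c p m j m)"
    using nabla31_trace[OF p, of "riemann g"] by simp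
  also have "\<dots> = (\<Sum>m\<in>UNIV. nabla11 g (\<lambda>c p j m. \<Sum>r\<in>UNIV. ginv g c p m r * - ricci g c p j r) c p m j m)"
    by (intro sum.cong refl nabla11_cong[OF p] riemann_trace_middle)
  also have "\<dots> = - (\<Sum>m\<in>UNIV. \<Sum>r\<in>UNIV. ?H m r * ?N m j r)"
    using nabla11_raise[OF p, of "\<lambda>c p k l. - ricci g c p k l"] by (simp add: minus sum_negf)
  finally have 1: "(\<Sum>k\<in>UNIV. \<Sum>l\<in>UNIV. ?H k l * (?N k j l - ?N j k l))
      = - (\<Sum>m\<in>UNIV. \<Sum>r\<in>UNIV. ?H m r * ?N m j r)"
    by (simp only: bianchi_contracted[OF p])
  have 2: "(\<Sum>k\<in>UNIV. \<Sum>l\<in>UNIV. ?H k l * ?N j k l) = pd c j (scalar_curv g c) p"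
    using nabla2_trace[OF p, of "ricci g"] by (simp add: scalar_curv_def[abs_def])
  show ?thesis
    using 1 by (simp add: right_diff_distrib sum_subtractf 2)
qed

text \<open>The antisymmetrized derivative of the Ricci tensor receives \<open>a\<close> from the
  divergence of the Riemann tensor and \<open>b\<close> from the products of \<open>kron\<close>
  with the Ricci tensor. Among the gradient terms, \<open>- b / 2\<close> is the divergence of
  \<open>ricci_mixed\<close>.\<close>

lemma divergence_quasi_conformal:
  fixes a b :: real
  defines "n \<equiv> real CARD('n)"
  assumes p: "p \<in> chart_dom c" and n: "n > 2"
  shows "(\<Sum>m\<in>UNIV. nabla31 g (quasi_conformal_curv a b g) c p m j k l m) =
    (a + b) * (nabla2 g (ricci g) c p k j l - nabla2 g (ricci g) c p j k l)
    + (b / (n - 1) + (a + (n - 2) * b) / (n * (n - 1)) - b / 2)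
      * (pd c j (scalar_curv g c) p * g c p $ k $ l - pd c k (scalar_curv g c) p * g c p $ j $ l)"
proof -
  \<comment> \<open>The coefficient of the scalar curvature in \<open>W\<close>: the first summand
    comes from \<open>conformal_curv\<close>, after \<open>n - 2\<close> cancels, the second from
    \<open>concircular_curv\<close>.\<close>
  define \<gamma> where "\<gamma> = b / (n - 1) + (a + (n - 2) * b) / (n * (n - 1))"
  define S where "S = (\<lambda>c p k l. (-b) * ricci g c p k l + \<gamma> * (scalar_curv g c p * g c p $ k $ l))"
  \<comment> \<open>\<open>W\<close> is \<open>a\<close> times the Riemann tensor plus the
    antisymmetrization of \<open>Y\<close> in its first two indices. Both summands of
    \<open>Y\<close> have a parallel factor, \<open>kron\<close> or the metric.\<close>
  define Y where "Y = (\<lambda>c p j k l m. 1 * (kron j m * S c p k l)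
    + (-b) * (ricci_mixed g c p j m * g c p $ k $ l))"
  have alg: "- (n - 2) * b * (x + 1 / (n - 2) * y - R / ((n - 1) * (n - 2)) * z)
      + (a + (n - 2) * b) * (x + R / (n * (n - 1)) * z)
    = a * x + (-b) * y + \<gamma> * R * z" for x y z R :: real
    using n unfolding \<gamma>_def by (simp add: divide_simps) algebra
  have W: "quasi_conformal_curv a b g = (\<lambda>c p j k l m. a * riemann g c p j k l m
    + 1 * (1 * Y c p j k l m + (-1) * Y c p k j l m))"
    unfolding quasi_conformal_curv_def conformal_curv_def concircular_curv_def Let_def
      n_def[symmetric] alg
    by (intro ext) (simp add: Y_def S_def algebra_simps)
  have smS: "smooth_in c (\<lambda>p. S c p k l)" for k l unfolding S_def by simp
  have smY: "smooth_in c (\<lambda>p. Y c p j k l m)" for j k l m unfolding Y_def using smS by simp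
  have S: "nabla2 g S c p i k l = (-b) * nabla2 g (ricci g) c p i k l
      + \<gamma> * (pd c i (scalar_curv g c) p * g c p $ k $ l)" for i k l
    unfolding S_def
    by (subst nabla2_linear[OF p]) (simp_all add: nabla2_scalar_metric[OF p])
  have Y: "nabla31 g Y c p i j k l m = kron j m * nabla2 g S c p i k l
      - b * (nabla11 g (ricci_mixed g) c p i j m * g c p $ k $ l)" for i j k l m
    unfolding Y_def using smS
    by (subst nabla31_linear[OF p]) (simp_all add: nabla31_kron[OF p] nabla31_mult_metric[OF p])
  have V: "(\<Sum>m\<in>UNIV. nabla11 g (ricci_mixed g) c p m j m) = pd c j (scalar_curv g c) p / 2" for j
    using nabla11_raise[OF p, of "ricci g"] ricci_divergence[OF p, of j]
    by (simp add: ricci_mixed_def[abs_def])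
  have divY: "(\<Sum>m\<in>UNIV. nabla31 g Y c p m j k l m) = nabla2 g S c p j k l
      - b * (pd c j (scalar_curv g c) p / 2 * g c p $ k $ l)" for j k l
    by (simp add: Y sum_subtractf flip: sum_distrib_left sum_distrib_right V)
  have "nabla31 g (\<lambda>c p j k l m. 1 * Y c p j k l m + (-1) * Y c p k j l m) c p i j k l m
      = 1 * nabla31 g Y c p i j k l m
        + (-1) * nabla31 g (\<lambda>c p j k l m. Y c p k j l m) c p i j k l m" for i m
    by (rule nabla31_linear[OF p]) (rule smY)+
  moreover have "nabla31 g (quasi_conformal_curv a b g) c p i j k l m =
      a * nabla31 g (riemann g) c p i j k l m + 1 *
        nabla31 g (\<lambda>c p j k l m. 1 * Y c p j k l m + (-1) * Y c p k j l m) c p i j k l m" for i m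
    unfolding W by (rule nabla31_linear[OF p]) (use smY in simp_all)
  ultimately have "nabla31 g (quasi_conformal_curv a b g) c p m j k l m =
    a * nabla31 g (riemann g) c p m j k l m
    + (nabla31 g Y c p m j k l m - nabla31 g Y c p m k j l m)" for m
    by (simp add: nabla31_swap[where A = Y])
  then have "(\<Sum>m\<in>UNIV. nabla31 g (quasi_conformal_curv a b g) c p m j k l m) =
    a * (nabla2 g (ricci g) c p k j l - nabla2 g (ricci g) c p j k l)
    + (nabla2 g S c p j k l - b * (pd c j (scalar_curv g c) p / 2 * g c p $ k $ l)
      - (nabla2 g S c p k j l - b * (pd c k (scalar_curv g c) p / 2 * g c p $ j $ l)))"
    by (simp add: sum.distrib sum_subtractf divY bianchi_contracted[OF p] flip: sum_distrib_left)
  then show ?thesis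
    by (simp add: S flip: \<gamma>_def) (simp add: algebra_simps)
qed

end

section \<open>The pointwise algebra\<close>

text \<open>At a point, \<open>G\<close> and \<open>H\<close> stand for the metric and its inverse, \<open>z'\<close>, \<open>f\<close>, \<open>N\<close> for the
  covariant derivatives of \<open>z\<close>, \<open>\<phi>\<close>, \<open>u\<close>, and \<open>\<rho>\<close>, \<open>s\<close> for those of the Ricci tensor
  \<open>z u \<otimes> u - \<phi> g\<close> and the scalar curvature \<open>z - n \<phi>\<close>.\<close>

lemma rank_one_ricci_parallel:
  fixes H G N :: "'n::finite \<Rightarrow> 'n \<Rightarrow> real" and u z' f A B D :: "'n \<Rightarrow> real" and z a b \<delta> n :: real
  defines "U \<equiv> \<lambda>k. \<Sum>m\<in>UNIV. H k m * u m"
  defines "\<rho> \<equiv> \<lambda>i j l. z' i * (u j * u l) + z * (N i j * u l + u j * N i l) - f i * G j l"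
  defines "s \<equiv> \<lambda>j. z' j - n * f j"
  assumes n: "n = real CARD('n)" "n > 3"
    and H: "\<And>k l. H k l = H l k" and G: "\<And>k l. G k l = G l k"
    and HG: "\<And>i j. (\<Sum>r\<in>UNIV. H i r * G r j) = kron i j"
    and unit: "(\<Sum>k\<in>UNIV. U k * u k) = 1"
    and UN: "\<And>k. (\<Sum>l\<in>UNIV. U l * N k l) = 0"
    and wzs: "\<And>k j l. z' k * (u j * u l) + z * (N k j * u l + u j * N k l) =
      A k * (z * (u j * u l)) + B j * (z * (u k * u l)) + D l * (z * (u k * u j))"
    and bianchi: "\<And>j. (\<Sum>m\<in>UNIV. \<Sum>r\<in>UNIV. H m r * \<rho> m j r) = s j / 2"
    and harmonic: "\<And>j k l. (a + b) * (\<rho> k j l - \<rho> j k l) + \<delta> * (s j * G k l - s k * G j l) = 0"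
    and f: "\<And>j k. u j * f k = u k * f j"
    and \<delta>: "\<delta> = b / (n - 1) + (a + (n - 2) * b) / (n * (n - 1)) - b / 2"
    and b: "b \<noteq> 0"
  shows "z * N k j = 0"
proof -
  define \<zeta> where "\<zeta> = (\<Sum>k\<in>UNIV. U k * z' k)"
  define F where "F = (\<Sum>k\<in>UNIV. U k * f k)"
  define \<beta> where "\<beta> = (\<Sum>k\<in>UNIV. U k * B k)"
  define \<alpha> where "\<alpha> j = z * (B j - \<beta> * u j)" for j
  define w where "w j = z' j - \<zeta> * u j" for j
  have f_eq: "f j = F * u j" for j
  proof -
    have "F * u j = (\<Sum>k\<in>UNIV. U k * (u j * f k))" by (simp add: F_def sum_distrib_left mult_ac)
    also have "\<dots> = (\<Sum>k\<in>UNIV. U k * u k) * f j"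
      by (simp only: f[of j]) (simp add: sum_distrib_left mult_ac)
    finally show ?thesis using unit by simp
  qed
  have U\<alpha>: "(\<Sum>k\<in>UNIV. U k * \<alpha> k) = 0"
  proof -
    have "(\<Sum>k\<in>UNIV. U k * \<alpha> k) = z * ((\<Sum>k\<in>UNIV. U k * B k) - \<beta> * (\<Sum>k\<in>UNIV. U k * u k))"
      by (simp add: \<alpha>_def algebra_simps sum_distrib_left sum_subtractf)
    then show ?thesis using unit by (simp add: \<beta>_def)
  qed
  \<comment> \<open>Later contractions with \<open>U\<close> are brought into this shape, with zero
    coefficients where a term is absent.\<close>
  have contr: "(\<Sum>k\<in>UNIV. U k * (x1 * u k + x2 * \<alpha> k + x3 * z' k)) = x1 + x3 * \<zeta>" for x1 x2 x3
  proof -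
    have "(\<Sum>k\<in>UNIV. U k * (x1 * u k + x2 * \<alpha> k + x3 * z' k)) =
      x1 * (\<Sum>k\<in>UNIV. U k * u k) + x2 * (\<Sum>k\<in>UNIV. U k * \<alpha> k) + x3 * (\<Sum>k\<in>UNIV. U k * z' k)"
      by (simp add: algebra_simps sum_distrib_left sum.distrib)
    then show ?thesis using unit U\<alpha> by (simp add: \<zeta>_def)
  qed
  \<comment> \<open>Contracting the defining equation with \<open>U\<close> in \<open>l\<close>,
    then also in \<open>j\<close>, gives \<open>c1\<close> and \<open>c2\<close>. Subtracting
    \<open>u j\<close> times \<open>c2\<close> from \<open>c1\<close> eliminates \<open>z'\<close>,
    \<open>A\<close> and \<epsilon>, and keeps only the part of \<open>B\<close> orthogonal to
    \<open>u\<close>.\<close>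
  have zN: "z * N k j = u k * \<alpha> j" for k j
  proof -
    define \<epsilon> where "\<epsilon> = (\<Sum>k\<in>UNIV. U k * D k)"
    have c1: "z' k * u j + z * N k j = A k * z * u j + B j * z * u k + \<epsilon> * z * u k * u j" for k j
    proof -
      have "z' k * u j * (\<Sum>l\<in>UNIV. U l * u l) + z * (N k j * (\<Sum>l\<in>UNIV. U l * u l)
          + u j * (\<Sum>l\<in>UNIV. U l * N k l))
        = (\<Sum>l\<in>UNIV. U l * (z' k * (u j * u l) + z * (N k j * u l + u j * N k l)))"
        by (simp add: algebra_simps sum_distrib_left sum.distrib)
      also have "\<dots> = A k * z * u j * (\<Sum>l\<in>UNIV. U l * u l)
          + B j * z * u k * (\<Sum>l\<in>UNIV. U l * u l) + z * u k * u j * (\<Sum>l\<in>UNIV. U l * D l)"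
        unfolding wzs by (simp add: algebra_simps sum_distrib_left sum.distrib)
      finally show ?thesis using unit UN by (simp add: \<epsilon>_def algebra_simps)
    qed
    have c2: "z' k = A k * z + \<beta> * z * u k + \<epsilon> * z * u k"
    proof -
      have "z' k * (\<Sum>j\<in>UNIV. U j * u j) + z * (\<Sum>j\<in>UNIV. U j * N k j)
        = (\<Sum>j\<in>UNIV. U j * (z' k * u j + z * N k j))"
        by (simp add: algebra_simps sum_distrib_left sum.distrib)
      also have "\<dots> = A k * z * (\<Sum>j\<in>UNIV. U j * u j) + z * u k * (\<Sum>j\<in>UNIV. U j * B j)
          + \<epsilon> * z * u k * (\<Sum>j\<in>UNIV. U j * u j)"
        unfolding c1 by (simp add: algebra_simps sum_distrib_left sum.distrib)
      finally show ?thesis using unit UN by (simp add: \<beta>_def algebra_simps)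
    qed
    show ?thesis using c1[of k j] c2 by (simp add: \<alpha>_def algebra_simps)
  qed
  \<comment> \<open>\<open>zN\<close> removes \<open>N\<close>; what is left is sorted by its
    dependence on \<open>l\<close>, ready for \<open>contrH\<close>.\<close>
  have \<rho>_eq: "\<rho> i j l = (z' i * u j + u i * \<alpha> j) * u l + (u j * u i) * \<alpha> l + (- F * u i) * G j l" for i j l
  proof -
    have "\<rho> i j l = z' i * (u j * u l) + ((z * N i j) * u l + u j * (z * N i l)) - f i * G j l"
      by (simp add: \<rho>_def algebra_simps)
    then show ?thesis by (simp add: zN f_eq algebra_simps)
  qed
  have HG': "(\<Sum>r\<in>UNIV. H k r * G j r) = kron k j" for k j
    using HG[of k j] G by simp
  have contrH: "(\<Sum>r\<in>UNIV. H m r * (x1 * u r + x2 * \<alpha> r + x3 * G j r + x4 * G k r))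
    = x1 * U m + x2 * (\<Sum>r\<in>UNIV. H m r * \<alpha> r) + x3 * kron m j + x4 * kron m k" for m j k x1 x2 x3 x4
    by (simp add: U_def algebra_simps sum_distrib_left sum.distrib flip: HG')
  have adj: "(\<Sum>m\<in>UNIV. u m * (\<Sum>r\<in>UNIV. H m r * y r)) = (\<Sum>r\<in>UNIV. U r * y r)" for y
  proof -
    have "U r = (\<Sum>m\<in>UNIV. u m * H m r)" for r by (simp add: U_def H[of r] mult.commute)
    then show ?thesis
      by (simp add: sum_distrib_left sum_distrib_right mult.assoc) (rule sum.swap)
  qed
  have u\<alpha>: "(\<Sum>m\<in>UNIV. u m * (\<Sum>r\<in>UNIV. H m r * \<alpha> r)) = 0"
    using adj U\<alpha> by simp
  have U: "(\<Sum>r\<in>UNIV. U r * G r j) = u j" for j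
    using adj[of "\<lambda>r. G r j"] by (simp add: HG)
  have div: "\<zeta> * u j + \<alpha> j - F * u j = s j / 2" for j
  proof -
    have "s j / 2 = (\<Sum>m\<in>UNIV. \<Sum>r\<in>UNIV. H m r *
        ((z' m * u j + u m * \<alpha> j) * u r + (u j * u m) * \<alpha> r + (- F * u m) * G j r + 0 * G j r))"
      unfolding bianchi[symmetric] \<rho>_eq by simp
    also have "\<dots> = (\<Sum>m\<in>UNIV. (z' m * u j + u m * \<alpha> j) * U m
        + (u j * u m) * (\<Sum>r\<in>UNIV. H m r * \<alpha> r) + (- F * u m) * kron m j)"
      unfolding contrH by simp
    also have "\<dots> = (\<Sum>m\<in>UNIV. U m * (\<alpha> j * u m + 0 * \<alpha> m + u j * z' m))
        + u j * (\<Sum>m\<in>UNIV. u m * (\<Sum>r\<in>UNIV. H m r * \<alpha> r)) - F * (\<Sum>m\<in>UNIV. u m * kron m j)"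
      by (simp add: sum.distrib sum_subtractf sum_distrib_left algebra_simps del: sum_kron)
    also have "\<dots> = \<alpha> j + u j * \<zeta> - F * u j"
      unfolding contr u\<alpha> by simp
    finally show ?thesis by (simp add: algebra_simps)
  qed
  \<comment> \<open>Contracting \<open>div\<close> with \<open>U\<close> kills \<alpha> and leaves
    \<open>\<zeta> - F = (\<zeta> - n F) / 2\<close>.\<close>
  have \<zeta>: "\<zeta> = (2 - n) * F"
  proof -
    have "(\<Sum>j\<in>UNIV. U j * (\<zeta> * u j + \<alpha> j - F * u j)) = (\<Sum>j\<in>UNIV. U j * (s j / 2))"
      by (simp only: div)
    then have "(\<Sum>j\<in>UNIV. U j * ((\<zeta> - F) * u j + 1 * \<alpha> j + 0 * z' j))
        = (\<Sum>j\<in>UNIV. U j * ((- n * F / 2) * u j + 0 * \<alpha> j + (1 / 2) * z' j))"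
      by (simp add: s_def f_eq algebra_simps diff_divide_distrib)
    then show ?thesis unfolding contr by (simp add: algebra_simps)
  qed
  have \<alpha>w: "\<alpha> j = w j / 2" for j
    using div[of j] by (simp add: s_def f_eq w_def \<zeta> field_simps)
  \<comment> \<open>The terms of \<open>harmonic\<close> with \<open>\<alpha> l\<close> are
    symmetric in \<open>j\<close> and \<open>k\<close> and cancel. Its dependence on
    \<open>l\<close> is then carried by \<open>u l\<close>, \<open>G j l\<close> and
    \<open>G k l\<close>, with coefficients given by \<open>C\<close> and \<open>E\<close>.\<close>
  define C where "C j k = (a + b) * (z' k * u j - z' j * u k + u k * \<alpha> j - u j * \<alpha> k)" for j k
  define E where "E j = (a + b) * F * u j + \<delta> * s j" for j
  have har: "C j k * u l + 0 * \<alpha> l + (- E k) * G j l + E j * G k l = 0" for j k l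
    using harmonic[of k j l] unfolding \<rho>_eq by (simp add: C_def E_def algebra_simps)
  have contr1: "C j k - E k * u j + E j * u k = 0" for j k
  proof -
    have "(\<Sum>l\<in>UNIV. U l * (C j k * u l + 0 * \<alpha> l + (- E k) * G j l + E j * G k l))
      = C j k * (\<Sum>l\<in>UNIV. U l * u l) + (- E k) * (\<Sum>l\<in>UNIV. U l * G l j)
        + E j * (\<Sum>l\<in>UNIV. U l * G l k)"
      by (simp add: G[of j] G[of k] algebra_simps sum_distrib_left sum.distrib sum_subtractf sum_negf)
    then show ?thesis unfolding har U unit by simp
  qed
  have UC: "(\<Sum>k\<in>UNIV. U k * C j k) = - ((a + b) * w j / 2)" for j
  proof -
    have "(\<Sum>k\<in>UNIV. U k * C j k) = (\<Sum>k\<in>UNIV. U k * (((a + b) * (\<alpha> j - z' j)) * u k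
        + (- (a + b) * u j) * \<alpha> k + ((a + b) * u j) * z' k))"
      by (simp add: C_def algebra_simps)
    then show ?thesis unfolding contr by (simp add: \<alpha>w[of j] w_def field_simps)
  qed
  have UE: "(\<Sum>k\<in>UNIV. U k * E k) = (a + b) * F + \<delta> * (\<zeta> - n * F)"
  proof -
    have "(\<Sum>k\<in>UNIV. U k * E k)
        = (\<Sum>k\<in>UNIV. U k * (((a + b) * F - \<delta> * n * F) * u k + 0 * \<alpha> k + \<delta> * z' k))"
      by (simp add: E_def s_def f_eq algebra_simps)
    then show ?thesis unfolding contr by (simp add: algebra_simps)
  qed
  have E_split: "E j = ((a + b) * F + \<delta> * (\<zeta> - n * F)) * u j + \<delta> * w j" for j
    by (simp add: E_def s_def f_eq w_def algebra_simps)
  \<comment> \<open>Contraction with \<open>U\<close> in \<open>l\<close> and then in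
    \<open>k\<close>; the parts of \<open>E j\<close> along \<open>u\<close> cancel, and the
    orthogonal parts are compared.\<close>
  have w1: "(\<delta> - (a + b) / 2) * w j = 0" for j
  proof -
    have "(\<Sum>k\<in>UNIV. U k * (C j k - E k * u j + E j * u k))
      = (\<Sum>k\<in>UNIV. U k * C j k) - (\<Sum>k\<in>UNIV. U k * E k) * u j + E j * (\<Sum>k\<in>UNIV. U k * u k)"
      by (simp add: algebra_simps sum_distrib_left sum.distrib sum_subtractf)
    then have "E j = ((a + b) * F + \<delta> * (\<zeta> - n * F)) * u j + (a + b) * w j / 2"
      unfolding contr1 UC UE unit by simp
    then show ?thesis by (simp add: E_split left_diff_distrib)
  qed
  \<comment> \<open>Contraction with \<open>H\<close> in \<open>k\<close> and \<open>l\<close>: the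
    trace \<open>n\<close> of the identity, less one from the term with \<open>E k\<close>, gives
    the factor \<open>n - 1\<close>.\<close>
  have trace: "- ((a + b) * w j / 2) + (n - 1) * E j = 0" for j
  proof -
    have "0 = (\<Sum>k\<in>UNIV. \<Sum>l\<in>UNIV. H k l * (C j k * u l + 0 * \<alpha> l + (- E k) * G j l + E j * G k l))"
      unfolding har by simp
    also have "\<dots> = (\<Sum>k\<in>UNIV. C j k * U k + 0 * (\<Sum>r\<in>UNIV. H k r * \<alpha> r)
        + (- E k) * kron k j + E j * kron k k)"
      unfolding contrH ..
    also have "\<dots> = (\<Sum>k\<in>UNIV. U k * C j k) - (\<Sum>k\<in>UNIV. E k * kron k j) + E j * n"
      by (simp add: sum.distrib sum_subtractf kron_def n mult_ac)
    finally show ?thesis unfolding UC by (simp add: algebra_simps)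
  qed
  have Uw: "(\<Sum>k\<in>UNIV. U k * w k) = 0"
    using contr[of "- \<zeta>" 0 1] by (simp add: w_def algebra_simps)
  \<comment> \<open>The component of \<open>trace\<close> along \<open>u\<close>, to which
    \<open>w\<close> does not contribute.\<close>
  have E0: "(\<Sum>k\<in>UNIV. U k * E k) = 0"
  proof -
    have lin: "(\<Sum>k\<in>UNIV. U k * (x * w k + y * E k))
      = x * (\<Sum>k\<in>UNIV. U k * w k) + y * (\<Sum>k\<in>UNIV. U k * E k)" for x y
      by (simp add: algebra_simps sum_distrib_left sum.distrib)
    have t0: "- ((a + b) / 2) * w k + (n - 1) * E k = 0" for k
      using trace[of k] by simp
    have "(n - 1) * (\<Sum>k\<in>UNIV. U k * E k) = 0"
      using lin[of "- ((a + b) / 2)" "n - 1"] unfolding t0 Uw by simp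
    then show ?thesis using n(2) by simp
  qed
  have E: "E j = \<delta> * w j" for j
    using E_split[of j] E0 UE by simp
  have w: "w j = 0" for j
  proof (rule ccontr)
    assume "w j \<noteq> 0"
    have "((n - 1) * \<delta> - (a + b) / 2) * w j = 0"
      using trace[of j] by (simp add: E left_diff_distrib)
    with \<open>w j \<noteq> 0\<close> have e1: "\<delta> = (a + b) / 2" and e2: "(n - 1) * \<delta> = (a + b) / 2"
      using w1[of j] by simp_all
    \<comment> \<open>\<open>e1\<close> and \<open>e2\<close> together say that
      \<open>(n - 1) \<delta>\<close> equals \<delta>.\<close>
    then have "(n - 2) * \<delta> = 0" by (simp add: algebra_simps)
    then have "\<delta> = 0" "a = - b" using n e1 by simp_all
    \<comment> \<open>For \<open>a = - b\<close> the constant \<delta> factors, and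
      \<open>n > 3\<close> with \<open>b\<close> nonzero keeps all factors nonzero, against
      \<open>\<delta> = 0\<close>.\<close>
    have "b / (n - 1) + (- b + (n - 2) * b) / (n * (n - 1)) - b / 2
        = - (b * ((n - 2) * (n - 3))) / (2 * n * (n - 1))"
      using n(2) by (simp add: divide_simps) (simp add: algebra_simps)
    then have "\<delta> = - (b * ((n - 2) * (n - 3))) / (2 * n * (n - 1))"
      unfolding \<delta> \<open>a = - b\<close> .
    with \<open>\<delta> = 0\<close> have "b * ((n - 2) * (n - 3)) = 0"
      using n(2) by simp
    then show False using n(2) b by simp
  qed
  show ?thesis by (simp add: zN \<alpha>w w)
qed

section \<open>From fields in a chart to the algebra at a point\<close>

context metric_chart
begin

lemma nabla2_cong:
  assumes "p \<in> chart_dom c" "\<And>q k l. q \<in> chart_dom c \<Longrightarrow> A c q k l = B c q k l"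
  shows "nabla2 g A c p i k l = nabla2 g B c p i k l"
  using pd_cong[OF open_dom, of p "\<lambda>q. A c q k l" "\<lambda>q. B c q k l"] assms
  by (simp add: nabla2_def)

lemma nabla2_outer:
  assumes p: "p \<in> chart_dom c" and f: "smooth_in c f" and X: "\<And>k. smooth_in c (\<lambda>q. X c q $ k)"
  shows "nabla2 g (\<lambda>c p j l. f p * (X c p $ j * X c p $ l)) c p k j l =
    pd c k f p * (X c p $ j * X c p $ l)
    + f p * (nabla1 g X c p k j * X c p $ l + X c p $ j * nabla1 g X c p k l)"
  using p f X
  by (simp add: nabla2_def nabla1_def pd_mult_smooth algebra_simps sum_distrib_left)

text \<open>\<open>X\<close> plays the normalized covector and \<open>h\<close> the length it was
  divided by. The unit condition and the defining equation are assumed on the whole chart domain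
  because their consequences get differentiated; \<open>X_\<phi>\<close>, \<open>harmonic\<close>
  and \<open>nonzero\<close> enter at \<open>p\<close> alone.\<close>

lemma weakly_Z_symmetric_parallel:
  fixes \<phi> :: "'p \<Rightarrow> real" and X A B D :: "('p, 'n) covec" and a b :: real
  assumes p: "p \<in> chart_dom c" and dim: "CARD('n) > 3" and b: "b \<noteq> 0"
    and smooth_\<phi>: "smooth_in c \<phi>" and smooth_X: "\<And>k. smooth_in c (\<lambda>q. X c q $ k)"
    and unit: "\<And>q. q \<in> chart_dom c \<Longrightarrow>
      (\<Sum>k\<in>UNIV. \<Sum>l\<in>UNIV. ginv g c q k l * (X c q $ k * X c q $ l)) = 1"
    and wzs: "\<And>q k j l. q \<in> chart_dom c \<Longrightarrow> nabla2 g (Z_tensor g \<phi>) c q k j l =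
        A c q $ k * Z_tensor g \<phi> c q j l + B c q $ j * Z_tensor g \<phi> c q k l
        + D c q $ l * Z_tensor g \<phi> c q k j"
    and BD: "\<And>q. q \<in> chart_dom c \<Longrightarrow> h q \<noteq> 0"
      "\<And>q j. q \<in> chart_dom c \<Longrightarrow> B c q $ j - D c q $ j = h q * X c q $ j"
    and X_\<phi>: "\<And>j k. X c p $ j * pd c k \<phi> p = X c p $ k * pd c j \<phi> p"
    and harmonic: "\<And>j k l. (\<Sum>m\<in>UNIV. nabla31 g (quasi_conformal_curv a b g) c p m j k l m) = 0"
    and nonzero: "Z_tensor g \<phi> c p k' l' \<noteq> 0"
  shows "nabla1 g X c p k j = 0"
proof -
  let ?Z = "Z_tensor g \<phi>"
  define n where "n = real CARD('n)"
  define U where "U q k = (\<Sum>m\<in>UNIV. ginv g c q k m * X c q $ m)" for q k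
  \<comment> \<open>The value of \<open>Z\<close> on the unit covector, taken twice with raised
    index. As a contraction of smooth components it is smooth even at the zeros of
    \<open>Z\<close>.\<close>
  define z where "z q = (\<Sum>k\<in>UNIV. \<Sum>l\<in>UNIV. U q k * (U q l * ?Z c q k l))" for q
  have smooth_Z: "smooth_in c (\<lambda>q. ?Z c q k l)" for k l
    using smooth_\<phi> by (simp add: Z_tensor_def)
  have smooth_U: "smooth_in c (\<lambda>q. U q k)" for k
    using smooth_X by (simp add: U_def)
  have smooth_z: "smooth_in c z"
    unfolding z_def using smooth_U smooth_Z by simp
  have UX: "(\<Sum>k\<in>UNIV. U q k * X c q $ k) = 1" if "q \<in> chart_dom c" for q
    using unit[OF that] by (simp add: U_def sum_distrib_left sum_distrib_right mult_ac)
  have Z_sym: "?Z c q k l = ?Z c q l k" if "q \<in> chart_dom c" for q k l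
    using ricci_sym[OF that] metric_sym[OF that] by (simp add: Z_tensor_def)
  have Z_eq: "?Z c q k l = z q * (X c q $ k * X c q $ l)" if q: "q \<in> chart_dom c" for q k l
  proof -
    \<comment> \<open>\<open>Z\<close> is symmetric and so is its derivative; exchanging
      \<open>j\<close> and \<open>l\<close> in the defining equation therefore leaves only the
      \<open>B\<close> and \<open>D\<close> terms, whose difference is a nonzero multiple of
      \<open>X\<close>.\<close>
    have ex: "X c q $ j * ?Z c q k l = X c q $ l * ?Z c q k j" for k j l
    proof -
      have "nabla2 g ?Z c q k j l = nabla2 g (\<lambda>c p k l. ?Z c p l k) c q k j l"
        by (rule nabla2_cong[OF q]) (rule Z_sym)
      also have "\<dots> = nabla2 g ?Z c q k l j"
        by (simp add: nabla2_def)
      finally have "A c q $ k * ?Z c q j l + B c q $ j * ?Z c q k l + D c q $ l * ?Z c q k j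
          = A c q $ k * ?Z c q j l + B c q $ l * ?Z c q k j + D c q $ j * ?Z c q k l"
        unfolding wzs[OF q] Z_sym[OF q, of l j] .
      then have "(B c q $ j - D c q $ j) * ?Z c q k l = (B c q $ l - D c q $ l) * ?Z c q k j"
        by (simp add: algebra_simps)
      then have "h q * (X c q $ j * ?Z c q k l) = h q * (X c q $ l * ?Z c q k j)"
        by (simp only: BD(2)[OF q] mult.assoc)
      then show ?thesis using BD(1)[OF q] by simp
    qed
    define y where "y k = (\<Sum>j\<in>UNIV. U q j * ?Z c q k j)" for k
    have Zy: "?Z c q k l = X c q $ l * y k" for k l
    proof -
      have "(\<Sum>j\<in>UNIV. U q j * X c q $ j) * ?Z c q k l = (\<Sum>j\<in>UNIV. U q j * (X c q $ j * ?Z c q k l))"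
        by (simp add: sum_distrib_right mult.assoc)
      also have "\<dots> = X c q $ l * y k"
        unfolding ex[of _ k l] y_def by (simp add: sum_distrib_left mult_ac)
      finally show ?thesis using UX[OF q] by simp
    qed
    \<comment> \<open>Symmetry of \<open>Z\<close> transfers the proportionality to \<open>X\<close>
      from the second index to the first.\<close>
    have y: "y k = X c q $ k * (\<Sum>l\<in>UNIV. U q l * y l)" for k
    proof -
      have "(\<Sum>l\<in>UNIV. U q l * X c q $ l) * y k = (\<Sum>l\<in>UNIV. U q l * (X c q $ l * y k))"
        by (simp add: sum_distrib_right mult.assoc)
      also have "\<dots> = (\<Sum>l\<in>UNIV. U q l * (X c q $ k * y l))"
        by (simp only: Zy[symmetric] Z_sym[OF q])
      finally show ?thesis using UX[OF q] by (simp add: sum_distrib_left mult_ac)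
    qed
    have "(\<Sum>l\<in>UNIV. U q l * y l) = z q"
      by (simp add: z_def y_def sum_distrib_left)
    note y[unfolded this]
    then show ?thesis using Zy by (simp add: mult_ac)
  qed
  define N where "N = nabla1 g X c p"
  have nabla_Z: "nabla2 g ?Z c p i j l = pd c i z p * (X c p $ j * X c p $ l)
      + z p * (N i j * X c p $ l + X c p $ j * N i l)" for i j l
  proof -
    have "nabla2 g ?Z c p i j l = nabla2 g (\<lambda>c p j l. z p * (X c p $ j * X c p $ l)) c p i j l"
      by (rule nabla2_cong[OF p]) (rule Z_eq)
    then show ?thesis
      using nabla2_outer[OF p smooth_z, of X] smooth_X by (simp add: N_def)
  qed
  have nabla_ricci: "nabla2 g (ricci g) c p i j l = pd c i z p * (X c p $ j * X c p $ l)
      + z p * (N i j * X c p $ l + X c p $ j * N i l) - pd c i \<phi> p * g c p $ j $ l" for i j l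
  proof -
    have "?Z = (\<lambda>c p k l. 1 * ricci g c p k l + 1 * (\<phi> p * g c p $ k $ l))"
      by (simp add: Z_tensor_def fun_eq_iff)
    then have "nabla2 g ?Z c p i j l = 1 * nabla2 g (ricci g) c p i j l
        + 1 * nabla2 g (\<lambda>c p k l. \<phi> p * g c p $ k $ l) c p i j l"
      using nabla2_linear[OF p, of "ricci g" "\<lambda>c p k l. \<phi> p * g c p $ k $ l" 1 1 i j l] smooth_\<phi> by simp
    then show ?thesis
      using nabla2_scalar_metric[OF p, of "\<lambda>c. \<phi>"] smooth_\<phi> by (simp add: nabla_Z)
  qed
  have "scalar_curv g c q = z q - n * \<phi> q" if q: "q \<in> chart_dom c" for q
  proof -
    have "ricci g c q i j = z q * (X c q $ i * X c q $ j) - \<phi> q * g c q $ i $ j" for i j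
      using Z_eq[OF q, of i j] by (simp add: Z_tensor_def)
    then have "scalar_curv g c q
      = z q * (\<Sum>k\<in>UNIV. \<Sum>l\<in>UNIV. ginv g c q k l * (X c q $ k * X c q $ l))
        - \<phi> q * (\<Sum>k\<in>UNIV. \<Sum>l\<in>UNIV. ginv g c q k l * g c q $ l $ k)"
      by (simp add: scalar_curv_def metric_sym[OF q] right_diff_distrib sum_subtractf sum_distrib_left mult_ac)
    then show ?thesis
      unfolding unit[OF q] ginv_metric[OF q] by (simp add: kron_def n_def)
  qed
  then have scalar: "pd c j (scalar_curv g c) p = pd c j z p - n * pd c j \<phi> p" for j
    using pd_cong[OF open_dom p p, of "scalar_curv g c" "\<lambda>q. z q - n * \<phi> q"] p smooth_z smooth_\<phi>
    by (simp add: pd_diff pd_cmult)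
  have UN: "(\<Sum>l\<in>UNIV. U p l * N k l) = 0" for k
  proof -
    \<comment> \<open>Differentiates the constant length of \<open>X\<close>; the factor 1 fits the
      shape of \<open>nabla2_outer\<close> with constant \<open>f\<close>.\<close>
    have "pd c k (\<lambda>q. \<Sum>k\<in>UNIV. \<Sum>l\<in>UNIV. ginv g c q k l * (1 * (X c q $ k * X c q $ l))) p = 0"
      using pd_cong[OF open_dom p p, of "\<lambda>q. \<Sum>k\<in>UNIV. \<Sum>l\<in>UNIV. ginv g c q k l * (X c q $ k * X c q $ l)"
          "\<lambda>q. 1"] unit by simp
    then have "(\<Sum>j\<in>UNIV. \<Sum>l\<in>UNIV. ginv g c p j l * (N k j * X c p $ l + X c p $ j * N k l)) = 0"
      using nabla2_trace[OF p, of "\<lambda>c p k l. 1 * (X c p $ k * X c p $ l)" k]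
        nabla2_outer[OF p, of "\<lambda>q. 1" X] smooth_X by (simp add: N_def)
    moreover have "(\<Sum>j\<in>UNIV. \<Sum>l\<in>UNIV. ginv g c p j l * (N k j * X c p $ l)) = (\<Sum>l\<in>UNIV. U p l * N k l)"
      by (simp add: U_def sum_distrib_left sum_distrib_right mult_ac)
    moreover have "(\<Sum>j\<in>UNIV. \<Sum>l\<in>UNIV. ginv g c p j l * (X c p $ j * N k l)) = (\<Sum>l\<in>UNIV. U p l * N k l)"
      by (subst sum.swap) (simp add: U_def sum_distrib_left sum_distrib_right mult_ac ginv_sym[OF p])
    ultimately show ?thesis by (simp add: distrib_left sum.distrib)
  qed
  have "z p * N k j = 0"
  proof (rule rank_one_ricci_parallel[where H = "ginv g c p" and G = "\<lambda>i j. g c p $ i $ j" and u = "\<lambda>k. X c p $ k"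
        and z' = "\<lambda>k. pd c k z p" and f = "\<lambda>k. pd c k \<phi> p" and n = n and b = b and a = a
        and A = "\<lambda>k. A c p $ k" and B = "\<lambda>k. B c p $ k" and D = "\<lambda>k. D c p $ k"])
    show "n = real CARD('n)" "n > 3" using dim by (simp_all add: n_def)
    show "ginv g c p k l = ginv g c p l k" "g c p $ k $ l = g c p $ l $ k" for k l
      using ginv_sym[OF p] metric_sym[OF p] by auto
    show "(\<Sum>r\<in>UNIV. ginv g c p i r * g c p $ r $ j) = kron i j" for i j
      by (rule ginv_metric[OF p])
    show "(\<Sum>k\<in>UNIV. (\<Sum>m\<in>UNIV. ginv g c p k m * X c p $ m) * X c p $ k) = 1"
      using UX[OF p] by (simp add: U_def)
    show "(\<Sum>l\<in>UNIV. (\<Sum>m\<in>UNIV. ginv g c p l m * X c p $ m) * N k l) = 0" for k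
      using UN by (simp add: U_def)
    show "pd c k z p * (X c p $ j * X c p $ l) + z p * (N k j * X c p $ l + X c p $ j * N k l) =
      A c p $ k * (z p * (X c p $ j * X c p $ l)) + B c p $ j * (z p * (X c p $ k * X c p $ l))
      + D c p $ l * (z p * (X c p $ k * X c p $ j))" for k j l
      using wzs[OF p, of k j l] by (simp only: nabla_Z Z_eq[OF p])
    show "(\<Sum>m\<in>UNIV. \<Sum>r\<in>UNIV. ginv g c p m r * (pd c m z p * (X c p $ j * X c p $ r)
        + z p * (N m j * X c p $ r + X c p $ j * N m r) - pd c m \<phi> p * g c p $ j $ r))
      = (pd c j z p - n * pd c j \<phi> p) / 2" for j
      using ricci_divergence[OF p, of j] by (simp only: nabla_ricci scalar)
    show "(a + b) * ((pd c k z p * (X c p $ j * X c p $ l)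
        + z p * (N k j * X c p $ l + X c p $ j * N k l) - pd c k \<phi> p * g c p $ j $ l)
        - (pd c j z p * (X c p $ k * X c p $ l)
        + z p * (N j k * X c p $ l + X c p $ k * N j l) - pd c j \<phi> p * g c p $ k $ l))
      + (b / (n - 1) + (a + (n - 2) * b) / (n * (n - 1)) - b / 2)
        * ((pd c j z p - n * pd c j \<phi> p) * g c p $ k $ l
          - (pd c k z p - n * pd c k \<phi> p) * g c p $ j $ l) = 0" for j k l
      using divergence_quasi_conformal[OF p, of a b j k l] harmonic[of j k l] dim
      by (simp only: nabla_ricci scalar n_def)
  qed (use X_\<phi> b in auto)
  moreover have "z p \<noteq> 0" using nonzero Z_eq[OF p, of k' l'] by auto
  ultimately show ?thesis by (simp add: N_def)
qed

end

section \<open>Change of chart\<close>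

locale chart_change = c: metric_chart c g + d: metric_chart d g
  for c d :: "('p::topological_space, 'n::finite) chart" and g :: "('p, 'n) metric" +
  assumes smooth_transition:
      "smooth_on (coord d ` (chart_dom d \<inter> chart_dom c)) (\<lambda>y. coord c (param d y) $ i)"
    and metric_change: "p \<in> chart_dom c \<inter> chart_dom d \<Longrightarrow>
      g d p $ k $ l = (\<Sum>i\<in>UNIV. \<Sum>j\<in>UNIV. jac c d p i k * jac c d p j l * g c p $ i $ j)"
begin

lemma open_overlap: "open (coord d ` (chart_dom d \<inter> chart_dom c))"
  using c.open_dom d.open_dom by (intro d.open_coord_image) auto

lemma transition_differentiable:
  assumes "p \<in> chart_dom c" "p \<in> chart_dom d"
  shows "pd_differentiable d (\<lambda>q. coord c q $ i) p"
  using smooth_transition[unfolded smooth_on_def, rule_format, of 1 i] assms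
  by (auto simp: pd_differentiable_def comp_def)

lemma jac_differentiable:
  assumes p: "p \<in> chart_dom c" "p \<in> chart_dom d"
  shows "pd_differentiable d (\<lambda>q. jac c d q i k) p"
  unfolding pd_differentiable_def
proof (rule differentiable_cong_open[OF open_overlap])
  let ?F = "\<lambda>y. coord c (param d y) $ i"
  show "coord d p \<in> coord d ` (chart_dom d \<inter> chart_dom c)" using p by auto
  show "partial k ?F differentiable at (coord d p)"
    using smooth_transition[unfolded smooth_on_def, rule_format, of 2 i] p
    by (auto simp: numeral_2_eq_2)
  show "partial k ?F y = ((\<lambda>q. jac c d q i k) \<circ> param d) y"
    if "y \<in> coord d ` (chart_dom d \<inter> chart_dom c)" for y
    using that by (auto simp: jac_def pd_def comp_def)
qed

lemma pd_jac_sym: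
  assumes p: "p \<in> chart_dom c" "p \<in> chart_dom d"
  shows "pd d l (\<lambda>q. jac c d q i k) p = pd d k (\<lambda>q. jac c d q i l) p"
proof -
  let ?F = "\<lambda>y. coord c (param d y) $ i" and ?S = "coord d ` (chart_dom d \<inter> chart_dom c)"
  have x: "coord d p \<in> ?S" using p by auto
  have "pd d l (\<lambda>q. jac c d q i k) p = partial l (partial k ?F) (coord d p)" for k l
    unfolding pd_def[of d l]
    by (rule partial_cong[OF open_overlap x]) (auto simp: jac_def pd_def comp_def)
  then show ?thesis
    using partial_commute[OF open_overlap x, of ?F l k] smooth_transition[unfolded smooth_on_def] by simp
qed

definition J :: "'p \<Rightarrow> real^'n^'n" where
  "J p = (\<chi> i k. jac c d p i k)"

lemma metric_change_matrix:
  assumes "p \<in> chart_dom c" "p \<in> chart_dom d"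
  shows "g d p = transpose (J p) ** g c p ** J p"
proof -
  have "(transpose (J p) ** g c p ** J p) $ k $ l = g d p $ k $ l" for k l
  proof -
    have "(transpose (J p) ** g c p ** J p) $ k $ l
      = (\<Sum>j\<in>UNIV. \<Sum>i\<in>UNIV. jac c d p i k * jac c d p j l * g c p $ i $ j)"
      by (simp add: J_def matrix_matrix_mult_def transpose_def sum_distrib_left mult_ac)
    also have "\<dots> = g d p $ k $ l"
      using assms by (subst sum.swap) (simp add: metric_change)
    finally show ?thesis .
  qed
  then show ?thesis by (simp add: vec_eq_iff)
qed

text \<open>A nonzero kernel vector of the Jacobian would be a null vector of \<open>g d p\<close>,
  contrary to positive definiteness.\<close>

lemma invertible_J:
  assumes p: "p \<in> chart_dom c" "p \<in> chart_dom d"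
  shows "invertible (J p)"
proof -
  have "v = 0" if "J p *v v = 0" for v
  proof (rule ccontr)
    assume "v \<noteq> 0"
    then have "v \<bullet> (g d p *v v) > 0" using d.metric_pos p by simp
    moreover have "g d p *v v = 0"
      using that by (simp add: metric_change_matrix[OF p] flip: matrix_vector_mul_assoc)
    ultimately show False by simp
  qed
  then show ?thesis by (auto simp: invertible_left_inverse matrix_left_invertible_ker)
qed

lemma transpose_J_inj:
  assumes p: "p \<in> chart_dom c" "p \<in> chart_dom d" and "transpose (J p) *v x = transpose (J p) *v y"
  shows "x = y"
proof -
  have "invertible (transpose (J p))" using invertible_J[OF p] by (rule transpose_invertible)
  then obtain K where "K ** transpose (J p) = mat 1" by (auto simp: invertible_def)
  then show ?thesis
    using assms(3) by (metis matrix_vector_mul_assoc matrix_vector_mul_lid)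
qed

text \<open>With the index raised, \<open>v\<close> transforms as a vector: \<open>J p\<close> maps
  \<open>v d\<close> to \<open>v c\<close>. The squared norm is the pairing of covector and vector,
  and the two Jacobians in it match.\<close>

lemma conorm_change:
  assumes p: "p \<in> chart_dom c" "p \<in> chart_dom d"
    and X: "\<And>k. X d p $ k = (\<Sum>i\<in>UNIV. jac c d p i k * X c p $ i)"
  shows "conorm g X d p = conorm g X c p"
proof -
  have conorm: "conorm g X e p = sqrt (X e p \<bullet> (matrix_inv (g e p) *v X e p))" for e
    by (simp add: conorm_def ginv_def inner_vec_def matrix_vector_mult_def sum_distrib_left mult_ac)
  define v where "v e = matrix_inv (g e p) *v X e p" for e
  have Xd: "X d p = transpose (J p) *v X c p"
    by (simp add: vec_eq_iff X J_def matrix_vector_mult_def transpose_def)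
  have "g d p *v v d = X d p"
    using matrix_inv_inverse[OF d.metric_invertible[OF p(2)]]
    by (simp add: v_def matrix_vector_mul_assoc)
  then have "transpose (J p) *v (g c p *v (J p *v v d)) = transpose (J p) *v X c p"
    using Xd by (simp add: metric_change_matrix[OF p] matrix_vector_mul_assoc matrix_mul_assoc)
  then have "g c p *v (J p *v v d) = X c p" by (rule transpose_J_inj[OF p])
  then have "J p *v v d = v c"
    using matrix_inv_inverse[OF c.metric_invertible[OF p(1)]]
    unfolding v_def[of c] by (metis matrix_vector_mul_assoc matrix_vector_mul_lid)
  then have "X d p \<bullet> v d = X c p \<bullet> v c"
    by (simp add: Xd dot_lmul_matrix flip: vector_transpose_matrix[of "transpose (J p)", unfolded transpose_transpose])
  then show ?thesis by (simp add: conorm v_def)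
qed

text \<open>\<open>P\<close> collects the terms with second derivatives of the transition map,
  \<open>T\<close> those with derivatives of the metric components.\<close>

lemma pd_metric_change:
  assumes p: "p \<in> chart_dom c" "p \<in> chart_dom d"
  defines "P \<equiv> \<lambda>k r l. \<Sum>i\<in>UNIV. \<Sum>j\<in>UNIV. pd d k (\<lambda>q. jac c d q i r) p * jac c d p j l * g c p $ i $ j"
    and "T \<equiv> \<lambda>k r l. \<Sum>h\<in>UNIV. \<Sum>i\<in>UNIV. \<Sum>j\<in>UNIV.
      jac c d p h k * jac c d p i r * jac c d p j l * pd c h (\<lambda>q. g c q $ i $ j) p"
  shows "pd d k (\<lambda>q. g d q $ r $ l) p = P k r l + P k l r + T k r l"
proof -
  have gd: "pd_differentiable d (\<lambda>q. g c q $ i $ j) p"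
    "pd d k (\<lambda>q. g c q $ i $ j) p = (\<Sum>h\<in>UNIV. jac c d p h k * pd c h (\<lambda>q. g c q $ i $ j) p)" for i j
    using pd_chain[OF c.chart_axioms d.chart_axioms p transition_differentiable[OF p]]
      c.smooth_in_pd_differentiable[OF c.smooth_metric p(1)] by auto
  have "pd d k (\<lambda>q. g d q $ r $ l) p
    = pd d k (\<lambda>q. \<Sum>i\<in>UNIV. \<Sum>j\<in>UNIV. jac c d q i r * jac c d q j l * g c q $ i $ j) p"
    by (rule d.pd_cong[of "chart_dom c \<inter> chart_dom d"])
      (use p c.open_dom d.open_dom metric_change in auto)
  also have "\<dots> = (\<Sum>i\<in>UNIV. \<Sum>j\<in>UNIV.
      pd d k (\<lambda>q. jac c d q i r) p * jac c d p j l * g c p $ i $ j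
      + jac c d p i r * pd d k (\<lambda>q. jac c d q j l) p * g c p $ i $ j
      + jac c d p i r * jac c d p j l * pd d k (\<lambda>q. g c q $ i $ j) p)"
    using p by (simp add: pd_sum pd_mult gd(1) jac_differentiable distrib_right)
  also have "\<dots> = P k r l + (\<Sum>i\<in>UNIV. \<Sum>j\<in>UNIV. jac c d p i r * pd d k (\<lambda>q. jac c d q j l) p * g c p $ i $ j)
      + (\<Sum>i\<in>UNIV. \<Sum>j\<in>UNIV. jac c d p i r * jac c d p j l * pd d k (\<lambda>q. g c q $ i $ j) p)"
    by (simp add: P_def sum.distrib)
  also have "(\<Sum>i\<in>UNIV. \<Sum>j\<in>UNIV. jac c d p i r * pd d k (\<lambda>q. jac c d q j l) p * g c p $ i $ j) = P k l r"
    unfolding P_def by (subst sum.swap) (simp add: c.metric_sym[OF p(1)] mult_ac)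
  also have "(\<Sum>i\<in>UNIV. \<Sum>j\<in>UNIV. jac c d p i r * jac c d p j l * pd d k (\<lambda>q. g c q $ i $ j) p)
    = (\<Sum>i\<in>UNIV. \<Sum>j\<in>UNIV. \<Sum>h\<in>UNIV.
      jac c d p h k * jac c d p i r * jac c d p j l * pd c h (\<lambda>q. g c q $ i $ j) p)"
    unfolding gd(2) by (simp add: sum_distrib_left mult_ac)
  also have "\<dots> = T k r l"
    unfolding T_def by (subst sum_swap23) (rule sum.swap)
  finally show ?thesis .
qed

text \<open>The classical inhomogeneous law, with the Jacobian on the left so that its inverse does
  not appear. Both sides are lowered with \<open>g c p\<close> and pulled back by the transposed
  Jacobian, an injective operation that reduces the claim to symbols of the first kind.\<close>

lemma christoffel_change:
  assumes p: "p \<in> chart_dom c" "p \<in> chart_dom d"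
  shows "(\<Sum>m\<in>UNIV. jac c d p a m * christoffel g d p m k l) =
    pd d k (\<lambda>q. jac c d q a l) p
    + (\<Sum>i\<in>UNIV. \<Sum>j\<in>UNIV. jac c d p i k * jac c d p j l * christoffel g c p a i j)"
proof -
  define x where "x = (\<chi> a. \<Sum>m\<in>UNIV. jac c d p a m * christoffel g d p m k l)"
  define y where "y = (\<chi> a. pd d k (\<lambda>q. jac c d q a l) p
    + (\<Sum>i\<in>UNIV. \<Sum>j\<in>UNIV. jac c d p i k * jac c d p j l * christoffel g c p a i j))"
  define P where "P k r l = (\<Sum>i\<in>UNIV. \<Sum>j\<in>UNIV. pd d k (\<lambda>q. jac c d q i r) p * jac c d p j l * g c p $ i $ j)"
    for k r l
  define T where "T k r l = (\<Sum>h\<in>UNIV. \<Sum>i\<in>UNIV. \<Sum>j\<in>UNIV.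
      jac c d p h k * jac c d p i r * jac c d p j l * pd c h (\<lambda>q. g c q $ i $ j) p)" for k r l
  note pd_g = pd_metric_change[OF p, folded P_def T_def]
  have P_sym: "P k r l = P r k l" for k r l
    unfolding P_def using pd_jac_sym[OF p] by simp
  have "(transpose (J p) *v (g c p *v x)) $ r = (transpose (J p) *v (g c p *v y)) $ r" for r
  proof -
    have "x = J p *v (\<chi> m. christoffel g d p m k l)"
      by (simp add: vec_eq_iff x_def J_def matrix_vector_mult_def)
    then have "transpose (J p) *v (g c p *v x) = g d p *v (\<chi> m. christoffel g d p m k l)"
      by (simp add: metric_change_matrix[OF p] matrix_vector_mul_assoc matrix_mul_assoc)
    then have "(transpose (J p) *v (g c p *v x)) $ r = (\<Sum>m\<in>UNIV. g d p $ r $ m * christoffel g d p m k l)"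
      by (simp add: matrix_vector_mult_def)
    \<comment> \<open>\<open>P\<close> is symmetric in its first two arguments, so four of the six
      \<open>P\<close> terms cancel and the other two coincide.\<close>
    also have "\<dots> = P k l r + (T k r l + T l r k - T r k l) / 2"
      unfolding d.christoffel_lower[OF p(2)] pd_g
      using P_sym[of k r l] P_sym[of l r k] P_sym[of k l r] by (simp add: field_simps)
    also have "\<dots> = (transpose (J p) *v (g c p *v y)) $ r"
    proof -
      have T1: "(\<Sum>b\<in>UNIV. \<Sum>i\<in>UNIV. \<Sum>j\<in>UNIV. jac c d p b r * jac c d p i k * jac c d p j l
          * pd c i (\<lambda>q. g c q $ b $ j) p) = T k r l"
        unfolding T_def by (subst sum.swap) (simp add: mult_ac)
      have T2: "(\<Sum>b\<in>UNIV. \<Sum>i\<in>UNIV. \<Sum>j\<in>UNIV. jac c d p b r * jac c d p i k * jac c d p j l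
          * pd c j (\<lambda>q. g c q $ b $ i) p) = T l r k"
        unfolding T_def by (subst sum_swap23, subst sum.swap) (simp add: mult_ac)
      have "(transpose (J p) *v (g c p *v y)) $ r
        = (\<Sum>b\<in>UNIV. jac c d p b r * (\<Sum>a\<in>UNIV. g c p $ b $ a * pd d k (\<lambda>q. jac c d q a l) p))
          + (\<Sum>b\<in>UNIV. jac c d p b r * (\<Sum>a\<in>UNIV. \<Sum>i\<in>UNIV. \<Sum>j\<in>UNIV.
            jac c d p i k * jac c d p j l * (g c p $ b $ a * christoffel g c p a i j)))"
        by (simp add: y_def J_def matrix_vector_mult_def transpose_def distrib_left sum.distrib
            sum_distrib_left mult_ac)
      also have "(\<Sum>b\<in>UNIV. jac c d p b r * (\<Sum>a\<in>UNIV. g c p $ b $ a * pd d k (\<lambda>q. jac c d q a l) p)) = P k l r"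
        unfolding P_def sum_distrib_left by (subst sum.swap) (simp add: c.metric_sym[OF p(1)] mult_ac)
      also have "(\<Sum>b\<in>UNIV. jac c d p b r * (\<Sum>a\<in>UNIV. \<Sum>i\<in>UNIV. \<Sum>j\<in>UNIV.
            jac c d p i k * jac c d p j l * (g c p $ b $ a * christoffel g c p a i j)))
        = (\<Sum>b\<in>UNIV. \<Sum>i\<in>UNIV. \<Sum>j\<in>UNIV. jac c d p b r * jac c d p i k * jac c d p j l
            * (\<Sum>a\<in>UNIV. g c p $ b $ a * christoffel g c p a i j))"
      proof (intro sum.cong refl)
        fix b
        have "(\<Sum>a\<in>UNIV. \<Sum>i\<in>UNIV. \<Sum>j\<in>UNIV. jac c d p i k * jac c d p j l * (g c p $ b $ a * christoffel g c p a i j))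
          = (\<Sum>i\<in>UNIV. \<Sum>j\<in>UNIV. \<Sum>a\<in>UNIV. jac c d p i k * jac c d p j l * (g c p $ b $ a * christoffel g c p a i j))"
          by (subst sum.swap) (rule sum_swap23)
        then show "jac c d p b r * (\<Sum>a\<in>UNIV. \<Sum>i\<in>UNIV. \<Sum>j\<in>UNIV.
            jac c d p i k * jac c d p j l * (g c p $ b $ a * christoffel g c p a i j))
          = (\<Sum>i\<in>UNIV. \<Sum>j\<in>UNIV. jac c d p b r * jac c d p i k * jac c d p j l
            * (\<Sum>a\<in>UNIV. g c p $ b $ a * christoffel g c p a i j))"
          by (simp add: sum_distrib_left mult.assoc)
      qed
      also have "\<dots> = (T k r l + T l r k - T r k l) / 2"
        unfolding c.christoffel_lower[OF p(1)]
        by (simp add: distrib_left right_diff_distrib sum.distrib sum_subtractf T1 T2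
            flip: sum_divide_distrib) (simp add: T_def)
      finally show ?thesis by simp
    qed
    finally show ?thesis .
  qed
  then have "transpose (J p) *v (g c p *v x) = transpose (J p) *v (g c p *v y)"
    by (simp add: vec_eq_iff)
  then have "g c p *v x = g c p *v y" by (rule transpose_J_inj[OF p])
  then have "x = y"
    using matrix_inv_inverse[OF c.metric_invertible[OF p(1)]]
    by (metis matrix_vector_mul_assoc matrix_vector_mul_lid)
  from arg_cong[OF this, of "\<lambda>v. v $ a"] show ?thesis by (simp add: x_def y_def)
qed

text \<open>The derivative of the Jacobian in the product rule cancels against the inhomogeneous
  term of \<open>christoffel_change\<close>.\<close>

lemma nabla1_change:
  assumes p: "p \<in> chart_dom c" "p \<in> chart_dom d"
    and smooth: "\<And>i. smooth_in c (\<lambda>q. X c q $ i)"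
    and X: "\<And>q k. q \<in> chart_dom c \<inter> chart_dom d \<Longrightarrow>
      X d q $ k = (\<Sum>i\<in>UNIV. jac c d q i k * X c q $ i)"
  shows "nabla1 g X d p k l =
    (\<Sum>i\<in>UNIV. \<Sum>j\<in>UNIV. jac c d p i k * jac c d p j l * nabla1 g X c p i j)"
proof -
  have Xd: "pd_differentiable d (\<lambda>q. X c q $ j) p"
    "pd d k (\<lambda>q. X c q $ j) p = (\<Sum>i\<in>UNIV. jac c d p i k * pd c i (\<lambda>q. X c q $ j) p)" for j
    using pd_chain[OF c.chart_axioms d.chart_axioms p transition_differentiable[OF p]]
      c.smooth_in_pd_differentiable[OF smooth p(1)] by auto
  have "pd d k (\<lambda>q. X d q $ l) p = pd d k (\<lambda>q. \<Sum>j\<in>UNIV. jac c d q j l * X c q $ j) p"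
    by (rule d.pd_cong[of "chart_dom c \<inter> chart_dom d"]) (use p c.open_dom d.open_dom X in auto)
  also have "\<dots> = (\<Sum>j\<in>UNIV. pd d k (\<lambda>q. jac c d q j l) p * X c p $ j)
      + (\<Sum>j\<in>UNIV. \<Sum>i\<in>UNIV. jac c d p i k * jac c d p j l * pd c i (\<lambda>q. X c q $ j) p)"
    using p by (simp add: pd_sum pd_mult Xd jac_differentiable sum.distrib sum_distrib_left mult_ac)
  finally have 1: "pd d k (\<lambda>q. X d q $ l) p = (\<Sum>j\<in>UNIV. pd d k (\<lambda>q. jac c d q j l) p * X c p $ j)
      + (\<Sum>i\<in>UNIV. \<Sum>j\<in>UNIV. jac c d p i k * jac c d p j l * pd c i (\<lambda>q. X c q $ j) p)"
    by (subst (asm) sum.swap)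
  have "(\<Sum>m\<in>UNIV. christoffel g d p m k l * X d p $ m)
    = (\<Sum>a\<in>UNIV. (\<Sum>m\<in>UNIV. jac c d p a m * christoffel g d p m k l) * X c p $ a)"
    using p by (simp add: X sum_distrib_left sum_distrib_right mult_ac) (rule sum.swap)
  also have "\<dots> = (\<Sum>a\<in>UNIV. pd d k (\<lambda>q. jac c d q a l) p * X c p $ a)
    + (\<Sum>a\<in>UNIV. \<Sum>i\<in>UNIV. \<Sum>j\<in>UNIV. jac c d p i k * jac c d p j l * (christoffel g c p a i j * X c p $ a))"
    unfolding christoffel_change[OF p]
    by (simp add: distrib_right sum.distrib sum_distrib_right mult.assoc)
  also have "(\<Sum>a\<in>UNIV. \<Sum>i\<in>UNIV. \<Sum>j\<in>UNIV. jac c d p i k * jac c d p j l * (christoffel g c p a i j * X c p $ a))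
    = (\<Sum>i\<in>UNIV. \<Sum>j\<in>UNIV. jac c d p i k * jac c d p j l * (\<Sum>a\<in>UNIV. christoffel g c p a i j * X c p $ a))"
    unfolding sum_distrib_left by (subst sum.swap) (rule sum_swap23)
  finally show ?thesis
    unfolding nabla1_def 1 by (simp add: right_diff_distrib sum_subtractf)
qed

end

section \<open>Parallelism of the unit covector\<close>

lemma metric_chart_of_manifold:
  fixes M :: "('p::{t2_space,second_countable_topology}, 'n::finite) atlas"
  assumes "riemannian_manifold M g" "c \<in> M"
  shows "metric_chart c g"
  by (unfold_locales)
    (use assms in \<open>auto simp: riemannian_manifold_def smooth_manifold_def riemannian_metric_def\<close>)

lemma chart_change_of_manifold:
  fixes M :: "('p::{t2_space,second_countable_topology}, 'n::finite) atlas"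
  assumes "riemannian_manifold M g" "c \<in> M" "d \<in> M"
  shows "chart_change c d g"
proof -
  interpret c: metric_chart c g by (rule metric_chart_of_manifold[OF assms(1,2)])
  interpret d: metric_chart d g by (rule metric_chart_of_manifold[OF assms(1,3)])
  show ?thesis
    by (unfold_locales)
      (use assms in \<open>auto simp: riemannian_manifold_def smooth_manifold_def riemannian_metric_def\<close>)
qed

lemma covector_field_diff:
  fixes M :: "('p::{t2_space,second_countable_topology}, 'n::finite) atlas"
  assumes "riemannian_manifold M g" "covector_field M X" "covector_field M Y"
  shows "covector_field M (\<lambda>c p. X c p - Y c p)"
proof -
  have "smooth_in c (\<lambda>p. X c p $ k - Y c p $ k)" if "c \<in> M" for c k
  proof -
    interpret metric_chart c g by (rule metric_chart_of_manifold[OF assms(1) that])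
    show ?thesis using assms that by (simp add: covector_field_def)
  qed
  moreover have "X d p $ k - Y d p $ k = (\<Sum>i\<in>UNIV. jac c d p i k * (X c p $ i - Y c p $ i))"
    if "c \<in> M" "d \<in> M" "p \<in> chart_dom c \<inter> chart_dom d" for c d p k
  proof -
    have "X d p $ k = (\<Sum>i\<in>UNIV. jac c d p i k * X c p $ i)"
      "Y d p $ k = (\<Sum>i\<in>UNIV. jac c d p i k * Y c p $ i)"
      using assms(2,3) that unfolding covector_field_def by blast+
    then show ?thesis by (simp add: right_diff_distrib sum_subtractf)
  qed
  ultimately show ?thesis unfolding covector_field_def vector_minus_component by blast
qed

section \<open>Normalization of a covector\<close>

context metric_chart
begin

text \<open>Writing \<open>X\<close> as the metric applied to \<open>v\<close> turns the expression
  into the metric evaluated on \<open>v\<close>.\<close>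

lemma conorm_square_pos:
  assumes p: "p \<in> chart_dom c" and X: "X c p \<noteq> 0"
  shows "(\<Sum>k\<in>UNIV. \<Sum>l\<in>UNIV. ginv g c p k l * X c p $ k * X c p $ l) > 0"
proof -
  define v where "v = matrix_inv (g c p) *v X c p"
  have gv: "g c p *v v = X c p"
    using matrix_inv_inverse[OF metric_invertible[OF p]]
    by (simp add: v_def matrix_vector_mul_assoc)
  then have "v \<noteq> 0" using X by auto
  then have "v \<bullet> X c p > 0" using metric_pos[OF p] gv by metis
  then show ?thesis
    by (simp add: v_def inner_vec_def matrix_vector_mult_def ginv_def sum_distrib_left sum_distrib_right mult_ac)
qed

lemma conorm_pos: "p \<in> chart_dom c \<Longrightarrow> X c p \<noteq> 0 \<Longrightarrow> conorm g X c p > 0"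
  using conorm_square_pos by (simp add: conorm_def)

lemma smooth_unit_covector:
  assumes smooth: "\<And>k. smooth_in c (\<lambda>p. X c p $ k)" and nz: "\<And>p. p \<in> chart_dom c \<Longrightarrow> X c p \<noteq> 0"
  shows "smooth_in c (\<lambda>p. ((1 / conorm g X c p) *\<^sub>R X c p) $ k)"
proof (rule smooth_in_cong)
  let ?Q = "\<lambda>p. \<Sum>k\<in>UNIV. \<Sum>l\<in>UNIV. ginv g c p k l * X c p $ k * X c p $ l"
  show "smooth_in c (\<lambda>p. ?Q p powr (- 1 / 2) * X c p $ k)"
    using smooth conorm_square_pos nz by (intro smooth_in_mult smooth_in_powr) auto
  show "?Q p powr (- 1 / 2) * X c p $ k = ((1 / conorm g X c p) *\<^sub>R X c p) $ k"
    if "p \<in> chart_dom c" for p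
  proof -
    have "x powr (- 1 / 2) = 1 / sqrt x" if "x > 0" for x :: real
      using powr_minus_divide[of x "1 / 2"] that by (simp add: powr_half_sqrt)
    from this[OF conorm_square_pos[where X = X, OF that nz[OF that]]] show ?thesis
      by (simp add: conorm_def)
  qed
qed

lemma unit_covector:
  assumes p: "p \<in> chart_dom c" and X: "X c p \<noteq> 0"
  defines "T \<equiv> (1 / conorm g X c p) *\<^sub>R X c p"
  shows "(\<Sum>k\<in>UNIV. \<Sum>l\<in>UNIV. ginv g c p k l * (T $ k * T $ l)) = 1"
proof -
  let ?Q = "\<Sum>k\<in>UNIV. \<Sum>l\<in>UNIV. ginv g c p k l * X c p $ k * X c p $ l"
  have "(\<Sum>k\<in>UNIV. \<Sum>l\<in>UNIV. ginv g c p k l * (T $ k * T $ l)) = ?Q / (conorm g X c p)\<^sup>2"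
    by (simp add: T_def power2_eq_square sum_divide_distrib mult_ac)
  also have "(conorm g X c p)\<^sup>2 = ?Q"
    using conorm_square_pos[where X = X, OF p X] by (simp add: conorm_def)
  finally show ?thesis using conorm_square_pos[where X = X, OF p X] by simp
qed

end

lemma covector_field_unit:
  fixes M :: "('p::{t2_space,second_countable_topology}, 'n::finite) atlas"
  assumes M: "riemannian_manifold M g" and X: "covector_field M X"
    and nz: "\<forall>c\<in>M. \<forall>p\<in>chart_dom c. X c p \<noteq> 0"
  shows "covector_field M (\<lambda>c p. (1 / conorm g X c p) *\<^sub>R X c p)"
proof -
  have "smooth_in c (\<lambda>p. ((1 / conorm g X c p) *\<^sub>R X c p) $ k)" if "c \<in> M" for c k
    using metric_chart.smooth_unit_covector[OF metric_chart_of_manifold[OF M that]] X nz that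
    by (simp add: covector_field_def)
  moreover have "((1 / conorm g X d p) *\<^sub>R X d p) $ k
      = (\<Sum>i\<in>UNIV. jac c d p i k * ((1 / conorm g X c p) *\<^sub>R X c p) $ i)"
    if "c \<in> M" "d \<in> M" "p \<in> chart_dom c \<inter> chart_dom d" for c d p k
  proof -
    have law: "X d p $ k = (\<Sum>i\<in>UNIV. jac c d p i k * X c p $ i)" for k
      using X that by (simp add: covector_field_def)
    then have "conorm g X d p = conorm g X c p"
      using chart_change.conorm_change[OF chart_change_of_manifold[OF M that(1,2)]] that(3) by simp
    then show ?thesis by (simp add: law sum_divide_distrib)
  qed
  ultimately show ?thesis unfolding covector_field_def by blast
qed

lemma parallel_imp_proper_concircular:
  fixes M :: "('p::{t2_space,second_countable_topology}, 'n::finite) atlas"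
  assumes M: "riemannian_manifold M g" and X: "covector_field M X"
    and parallel: "\<And>c p j l. c \<in> M \<Longrightarrow> p \<in> chart_dom c \<Longrightarrow> nabla1 g X c p j l = 0"
  shows "proper_concircular M g X"
proof -
  have const: "smooth_in c (\<lambda>p. 0)" if "c \<in> M" for c
  proof -
    interpret metric_chart c g by (rule metric_chart_of_manifold[OF M that])
    show ?thesis by simp
  qed
  have "covector_field M (\<lambda>c p. 0)" "scalar_field M (\<lambda>p. 0)" "closed_covector M g (\<lambda>c p. 0)"
    using const by (simp_all add: covector_field_def scalar_field_def closed_covector_def nabla1_def)
  then show ?thesis
    unfolding proper_concircular_def using X parallel
    by (intro conjI exI[of _ "\<lambda>c p. 0"] exI[of _ "\<lambda>p. 0"]) auto
qed

theorem theorem3p3: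
  fixes M :: "('p::{t2_space,second_countable_topology}, 'n::finite) atlas"
    and g :: "('p, 'n) metric"
    and \<phi> :: "'p \<Rightarrow> real"
    and A B D \<eta> :: "('p, 'n) covec"
    and a b :: real
  assumes manifold: "riemannian_manifold M g"
    and dim: "CARD('n) > 3"
    and wzs: "weakly_Z_symmetric M g \<phi> A B D"
    and nontrivial: "Z_nontrivial M g \<phi>"
    and ab: "a \<noteq> 0" "b \<noteq> 0"
    and harmonic: "quasi_conformally_harmonic a b M g"
    and eta: "\<eta> = (\<lambda>c p. B c p - D c p)"
    and eta_nonzero: "\<forall>c\<in>M. \<forall>p\<in>chart_dom c. \<eta> c p \<noteq> 0"
    and eta_phi: "\<forall>c\<in>M. \<forall>p\<in>chart_dom c. \<forall>j k.
      \<eta> c p $ j * pd c k \<phi> p - \<eta> c p $ k * pd c j \<phi> p = 0"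
  shows "proper_concircular M g (\<lambda>c p. (1 / conorm g \<eta> c p) *\<^sub>R \<eta> c p)"
proof -
  define T where "T = (\<lambda>c p. (1 / conorm g \<eta> c p) *\<^sub>R \<eta> c p)"
  have cov_\<eta>: "covector_field M \<eta>"
    unfolding eta using wzs by (intro covector_field_diff[OF manifold]) (auto simp: weakly_Z_symmetric_def)
  have cov_T: "covector_field M T"
    unfolding T_def by (rule covector_field_unit[OF manifold cov_\<eta> eta_nonzero])
  have parallel: "nabla1 g T c p k j = 0"
    if c: "c \<in> M" and p: "p \<in> chart_dom c" and nz: "Z_tensor g \<phi> c p k' l' \<noteq> 0" for c p k j k' l'
  proof -
    interpret metric_chart c g by (rule metric_chart_of_manifold[OF manifold c])
    have pos: "conorm g \<eta> c q > 0" if "q \<in> chart_dom c" for q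
      using conorm_pos[OF that] eta_nonzero c that by simp
    show ?thesis
    proof (rule weakly_Z_symmetric_parallel[OF p dim ab(2)])
      show "smooth_in c \<phi>" using wzs c by (simp add: weakly_Z_symmetric_def scalar_field_def)
      show "smooth_in c (\<lambda>q. T c q $ k)" for k using cov_T c by (simp add: covector_field_def)
      show "(\<Sum>k\<in>UNIV. \<Sum>l\<in>UNIV. ginv g c q k l * (T c q $ k * T c q $ l)) = 1"
        if "q \<in> chart_dom c" for q
        using unit_covector[OF that, of \<eta>] eta_nonzero c that by (simp add: T_def)
      show "nabla2 g (Z_tensor g \<phi>) c q k j l =
        A c q $ k * Z_tensor g \<phi> c q j l + B c q $ j * Z_tensor g \<phi> c q k l
        + D c q $ l * Z_tensor g \<phi> c q k j" if "q \<in> chart_dom c" for q k j l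
        using wzs c that by (simp add: weakly_Z_symmetric_def)
      show "conorm g \<eta> c q \<noteq> 0" if "q \<in> chart_dom c" for q using pos[OF that] by simp
      show "B c q $ j - D c q $ j = conorm g \<eta> c q * T c q $ j" if "q \<in> chart_dom c" for q j
        using pos[OF that] by (simp add: T_def eta)
      show "T c p $ j * pd c k \<phi> p = T c p $ k * pd c j \<phi> p" for j k
        using eta_phi c p by (simp add: T_def)
      show "(\<Sum>m\<in>UNIV. nabla31 g (quasi_conformal_curv a b g) c p m j k l m) = 0" for j k l
        using harmonic c p by (simp add: quasi_conformally_harmonic_def)
      show "Z_tensor g \<phi> c p k' l' \<noteq> 0" by (rule nz)
    qed
  qed
  have "nabla1 g T c p j l = 0" if c: "c \<in> M" and p: "p \<in> chart_dom c" for c p j l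
  proof (rule ccontr)
    assume "nabla1 g T c p j l \<noteq> 0"
    interpret metric_chart c g by (rule metric_chart_of_manifold[OF manifold c])
    have smooth_T: "smooth_in c (\<lambda>q. T c q $ k)" for k using cov_T c by (simp add: covector_field_def)
    have "smooth_in c (\<lambda>q. nabla1 g T c q j l)"
      unfolding nabla1_def using smooth_T by simp
    then have cont: "continuous_on (chart_dom c) (\<lambda>q. nabla1 g T c q j l)"
      by (rule smooth_in_continuous)
    \<comment> \<open>A nonzero component would persist on an open set, which by nontriviality
      contains a point where \<open>Z\<close> is nonzero.\<close>
    define V where "V = chart_dom c \<inter> (\<lambda>q. nabla1 g T c q j l) -` (- {0})"
    have "open V" unfolding V_def
      by (rule continuous_open_preimage[OF cont open_dom]) auto
    moreover have "p \<in> V" using p \<open>nabla1 g T c p j l \<noteq> 0\<close> by (simp add: V_def)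
    ultimately obtain d q k' l' where d: "d \<in> M" and q: "q \<in> V" "q \<in> chart_dom d"
      and nz: "Z_tensor g \<phi> d q k' l' \<noteq> 0"
      using nontrivial unfolding Z_nontrivial_def by blast
    \<comment> \<open>Nonvanishing of \<open>Z\<close> is known in the chart \<open>d\<close>, so
      \<open>parallel\<close> applies there; the transformation law carries the vanishing back to
      \<open>c\<close>.\<close>
    interpret change: chart_change d c g by (rule chart_change_of_manifold[OF manifold d c])
    have "q \<in> chart_dom c" using q by (simp add: V_def)
    then have "nabla1 g T c q j l
      = (\<Sum>h\<in>UNIV. \<Sum>i\<in>UNIV. jac d c q h j * jac d c q i l * nabla1 g T d q h i)"
      using cov_T d c q(2) by (intro change.nabla1_change) (auto simp: covector_field_def)
    also have "\<dots> = 0" by (simp add: parallel[OF d q(2) nz])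
    finally show False using q by (simp add: V_def)
  qed
  then show ?thesis
    using parallel_imp_proper_concircular[OF manifold cov_T] by (simp add: T_def)
qed

end
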